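(* Consider the expanding honeycomb resource-graph family and the direct all-shortest-path realization of general concurrence percolation (GCP) described in the context, with fixed $0<\theta<\pi/4$ and one uniformly random session $(s_1,t_1)$. For a link location $e\in E$ let $$\ell_e:=\sum_{\{u,v\}\subseteq V}\ \sum_{P\in\mathcal P_{uv}}\mathbf 1\{e\in P\}$$ be the number of prescribed elementary-pair uses at $e$. Then as $N\to\infty$ with $\theta$ fixed, the minimum aggregation window $W(N)$ that supplies all prescribed elementary-pair copies satisfies $$W(N)=\max_{e\in E}\ell_e=\exp[\Theta(\sqrt N)].$$ If the final processing is optimized over arbitrary LOCC acting only on the retained effective states, then $$\sup_{\text{final LOCC}}\ \frac1{W(N)}\,\mathbb E\big[d(s_1,t_1)\,B_1^{(W(N))}\big]=\exp[-\Theta(\sqrt N)],$$ where the expectation is over the uniformly sampled session and all processing outcomes. Independent singlet conversion of the retained states followed by maximum pure-Bell-pair routing attains the same stretched-exponential order.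
   Context: Graph family. $G=(V,E)$, $|V|=N\to\infty$, is a regular family of finite pieces of the honeycomb lattice of fixed shape and aspect ratio, embedded in the plane with fixed nearest-neighbour physical spacing. In honeycomb coordinates $(i,j,\sigma)$, $i,j\in\mathbb Z$, $\sigma\in\{0,1\}$, the vertex $(i,j,1)$ is adjacent to $(i,j,0),(i+1,j,0),(i,j+1,0)$. The family has maximum degree three, $|E|=\Theta(N)$, hop diameter $O(\sqrt N)$, and (up to choice of origin) contains a full coordinate block $0\le i,j\le m$ with $m=\Theta(\sqrt N)$. $d(u,v)$ is the physical distance between nodes $u,v$ (so $d=O(\sqrt N)$, and neighbours are at a fixed positive distance). Supply. Each edge (link location) has multiplicity one and in each activation slot deterministically supplies exactly one copy of $|\psi(\theta)\rangle=\cos\theta|00\rangle+\sin\theta|11\rangle$ shared by its endpoints. A window of $W$ slots starts empty, with ideal storage, and hence supplies exactly $W$ copies per link location. Demand. One session $(s_1,t_1)$, an unordered pair of distinct nodes chosen uniformly. Direct realization. For distinct $u,v$ let $\mathcal P_{uv}$ be the set of all shortest $u$–$v$ paths in $G$, with common hop length $h$. For every unordered pair $\{u,v\}$ and every $P\in\mathcal P_{uv}$, a distinct elementary-pair copy is assigned to each edge of $P$ (no copy is used twice). The concurrence series rule along $P$ yields a path state between $u$ and $v$ with concurrence $\sin^h(2\theta)$, whose reduced state has larger eigenvalue $\alpha_h=\tfrac12\big(1+\sqrt{1-\sin^{2h}(2\theta)}\big)$; the path states for $\{u,v\}$ are then converted by deterministic LOCC (the parallel rule) into one effective pure two-qubit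 state shared by $u,v$ whose larger squared Schmidt coefficient is $\max\{1/2,\alpha_h^{|\mathcal P_{uv}|}\}$ (for neighbours this is the elementary state itself). One effective state per unordered node pair is retained; all other quantum systems are discarded before final processing. Counting. Final processing is LOCC among the $N$ nodes (each node one party) on the retained states. $B_1^{(W(N))}$ is the number of output pairs for the session that are exactly ideal Bell pairs $|\Phi^+\rangle$ (fidelity threshold $F_\star=1$). Independent singlet conversion turns each retained state, with larger squared Schmidt coefficient $\lambda$, independently into a perfect Bell pair with probability $\min\{1,2(1-\lambda)\}$ (otherwise it is lost); maximum pure-Bell-pair routing then swaps along a maximum-size family of $s_1$–$t_1$ paths in the graph of resulting Bell pairs such that no Bell pair is reused. *)

theory Defs
  imports
    "HOL-Probability.Probability"
    "HOL-Library.Landau_Symbols"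
    "HOL-Library.Multiset"
    "HOL-Library.Ramsey"
begin

subsection \<open>Graphs and shortest paths\<close>

text \<open>
  A simple graph is a set of two-element edges; unordered pairs of distinct nodes are the elements
  of \<^term>\<open>nsets V 2\<close>. Paths are counted as edge sets, so that a vertex list and its reversal
  give the same path of an unordered pair.
\<close>

definition is_path :: "'v set set \<Rightarrow> 'v set \<Rightarrow> 'v list \<Rightarrow> bool" where
  "is_path E p xs \<longleftrightarrow> xs \<noteq> [] \<and> distinct xs \<and> successively (\<lambda>u v. {u, v} \<in> E) xs
     \<and> {hd xs, last xs} = p"

definition path_edges :: "'v list \<Rightarrow> 'v set set" where
  "path_edges xs = {{xs ! i, xs ! Suc i} | i. Suc i < length xs}"

definition hop_dist :: "'v set set \<Rightarrow> 'v set \<Rightarrow> nat" where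
  "hop_dist E p = (LEAST h. \<exists>xs. is_path E p xs \<and> length xs = Suc h)"

definition shortest_paths :: "'v set set \<Rightarrow> 'v set \<Rightarrow> 'v set set set" where
  "shortest_paths E p = {path_edges xs | xs. is_path E p xs \<and> length xs = Suc (hop_dist E p)}"


subsection \<open>Honeycomb pieces\<close>

text \<open>The third component is the sublattice index, with \<^term>\<open>True\<close> for 1.\<close>

type_synonym vertex = "int \<times> int \<times> bool"

definition honeycomb_edges :: "vertex set set" where
  "honeycomb_edges =
     {{(i, j, True), w} | i j w. w \<in> {(i, j, False), (i + 1, j, False), (i, j + 1, False)}}"

text \<open>
  The basis vectors of the triangular Bravais lattice have length \<open>a * sqrt 3\<close> and enclose an angle
  of 60 degrees; the second sublattice sits at the centroids of the triangles spanned by them.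
\<close>

definition honeycomb_pos :: "real \<Rightarrow> vertex \<Rightarrow> complex" where
  "honeycomb_pos a = (\<lambda>(i, j, s).
     Complex (a * sqrt 3 * (of_int i + of_int j / 2 + of_bool s / 2))
             (a * (3 * of_int j + of_bool s) / 2))"

definition phys_dist :: "real \<Rightarrow> vertex set \<Rightarrow> real" where
  "phys_dist a p =
     (THE x. \<exists>u v. p = {u, v} \<and> x = dist (honeycomb_pos a u) (honeycomb_pos a v))"

definition coord_block :: "int \<Rightarrow> int \<Rightarrow> nat \<Rightarrow> vertex set" where
  "coord_block i0 j0 m = {i0 .. i0 + int m} \<times> {j0 .. j0 + int m} \<times> UNIV"

definition honeycomb_piece :: "vertex set \<Rightarrow> vertex set set \<Rightarrow> bool" where
  "honeycomb_piece V E \<longleftrightarrow> finite V \<and> 2 \<le> card V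
     \<and> E \<subseteq> honeycomb_edges \<inter> nsets V 2
     \<and> (\<forall>p \<in> nsets V 2. \<exists>xs. is_path E p xs)"

definition honeycomb_family :: "(nat \<Rightarrow> vertex set) \<Rightarrow> (nat \<Rightarrow> vertex set set) \<Rightarrow> bool" where
  "honeycomb_family V E \<longleftrightarrow>
     (\<forall>n. honeycomb_piece (V n) (E n))
     \<and> filterlim (\<lambda>n. card (V n)) at_top sequentially
     \<and> (\<forall>n. \<forall>v \<in> V n. card {e \<in> E n. v \<in> e} \<le> 3)
     \<and> (\<lambda>n. real (card (E n))) \<in> \<Theta>(\<lambda>n. real (card (V n)))
     \<and> (\<lambda>n. real (Max (hop_dist (E n) ` nsets (V n) 2))) \<in> O(\<lambda>n. sqrt (real (card (V n))))
     \<and> (\<exists>m i0 j0. (\<lambda>n. real (m n)) \<in> \<Theta>(\<lambda>n. sqrt (real (card (V n))))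
          \<and> (\<forall>n. coord_block (i0 n) (j0 n) (m n) \<subseteq> V n
               \<and> honeycomb_edges \<inter> nsets (coord_block (i0 n) (j0 n) (m n)) 2 \<subseteq> E n))"


subsection \<open>Supply and prescribed elementary-pair uses\<close>

definition link_load :: "'v set \<Rightarrow> 'v set set \<Rightarrow> 'v set \<Rightarrow> nat" where
  "link_load V E e = (\<Sum>p \<in> nsets V 2. \<Sum>P \<in> shortest_paths E p. of_bool (e \<in> P))"

definition prescribed_uses :: "'v set \<Rightarrow> 'v set set \<Rightarrow> ('v set \<times> 'v set set \<times> 'v set) set" where
  "prescribed_uses V E = {(p, P, e). p \<in> nsets V 2 \<and> P \<in> shortest_paths E p \<and> e \<in> P}"

text \<open>The copies available in a window of \<open>w\<close> slots are the pairs (link location, slot).\<close>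

definition window_supplies :: "'v set \<Rightarrow> 'v set set \<Rightarrow> nat \<Rightarrow> bool" where
  "window_supplies V E w \<longleftrightarrow>
     (\<exists>f. inj_on f (prescribed_uses V E)
        \<and> (\<forall>(p, P, e) \<in> prescribed_uses V E. f (p, P, e) \<in> {e} \<times> {..<w}))"

definition min_window :: "'v set \<Rightarrow> 'v set set \<Rightarrow> nat" where
  "min_window V E = (LEAST w. window_supplies V E w)"


subsection \<open>Direct all-shortest-path realization\<close>

text \<open>A two-qubit vector is given by its amplitudes in the computational basis.\<close>

definition elementary_state :: "real \<Rightarrow> bool \<Rightarrow> bool \<Rightarrow> complex" where
  "elementary_state \<theta> b c =
     (if b \<noteq> c then 0 else if b then of_real (sin \<theta>) else of_real (cos \<theta>))"

definition concurrence :: "(bool \<Rightarrow> bool \<Rightarrow> complex) \<Rightarrow> real" where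
  "concurrence \<psi> = 2 * cmod (\<psi> False False * \<psi> True True - \<psi> False True * \<psi> True False)"

definition series_concurrence :: "real \<Rightarrow> 'v set set \<Rightarrow> real" where
  "series_concurrence \<theta> P = (\<Prod>e\<in>P. concurrence (elementary_state \<theta>))"

definition schmidt_of_concurrence :: "real \<Rightarrow> real" where
  "schmidt_of_concurrence c = (1 + sqrt (1 - c\<^sup>2)) / 2"

definition retained_schmidt :: "real \<Rightarrow> 'v set set \<Rightarrow> 'v set \<Rightarrow> real" where
  "retained_schmidt \<theta> E p =
     max (1 / 2) (\<Prod>P \<in> shortest_paths E p. schmidt_of_concurrence (series_concurrence \<theta> P))"

definition path_alpha :: "real \<Rightarrow> nat \<Rightarrow> real" where
  "path_alpha \<theta> h = (1 + sqrt (1 - sin (2 * \<theta>) ^ (2 * h))) / 2"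

lemma concurrence_elementary_state:
  assumes "0 < \<theta>" "\<theta> < pi / 4"
  shows "concurrence (elementary_state \<theta>) = sin (2 * \<theta>)"
proof -
  have "0 < sin \<theta>" "0 < cos \<theta>"
    using assms by (auto intro!: sin_gt_zero cos_gt_zero)
  then show ?thesis
    by (simp add: concurrence_def elementary_state_def sin_double norm_mult)
qed

lemma card_path_edges:
  assumes "distinct xs"
  shows "card (path_edges xs) = length xs - 1"
proof -
  have "path_edges xs = (\<lambda>i. {xs ! i, xs ! Suc i}) ` {..<length xs - 1}"
    by (auto simp: path_edges_def)
  moreover have "inj_on (\<lambda>i. {xs ! i, xs ! Suc i}) {..<length xs - 1}"
  proof (rule inj_onI)
    fix i j
    assume "i \<in> {..<length xs - 1}" "j \<in> {..<length xs - 1}"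
      and "{xs ! i, xs ! Suc i} = {xs ! j, xs ! Suc j}"
    then show "i = j"
      using assms by (auto simp: doubleton_eq_iff nth_eq_iff_index_eq)
  qed
  ultimately show ?thesis
    by (simp add: card_image)
qed

lemma retained_schmidt_eq:
  assumes "0 < \<theta>" "\<theta> < pi / 4"
  shows "retained_schmidt \<theta> E p =
    max (1 / 2) (path_alpha \<theta> (hop_dist E p) ^ card (shortest_paths E p))"
proof -
  have "schmidt_of_concurrence (series_concurrence \<theta> P) = path_alpha \<theta> (hop_dist E p)"
    if "P \<in> shortest_paths E p" for P
  proof -
    have "card P = hop_dist E p"
      using that by (auto simp: shortest_paths_def is_path_def card_path_edges)
    then show ?thesis
      using assms
      by (simp add: schmidt_of_concurrence_def series_concurrence_def path_alpha_def
          concurrence_elementary_state power_mult [symmetric] mult.commute)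
  qed
  then show ?thesis
    by (simp add: retained_schmidt_def)
qed


subsection \<open>LOCC\<close>

text \<open>
  The local Hilbert space of a party has a finite set of basis labels. A label is the set of those
  register names that carry the bit 1. Any finite dimension occurs (label sets need not be full
  power sets), and a register \<open>r\<close> is a qubit, that is a two-dimensional tensor factor, exactly if
  the label set is closed under setting and clearing \<open>r\<close>.

  A branch of a protocol consists of the current local label sets and an unnormalised density
  matrix indexed by the joint labels; its trace is the probability of the branch.
\<close>

type_synonym ('v, 'r) spaces = "'v \<Rightarrow> 'r set set"
type_synonym ('v, 'r) density = "('v \<Rightarrow> 'r set) \<Rightarrow> ('v \<Rightarrow> 'r set) \<Rightarrow> complex"
type_synonym ('v, 'r) branch = "('v, 'r) spaces \<times> ('v, 'r) density"
type_synonym 'r kraus = "'r set \<Rightarrow> 'r set \<Rightarrow> complex"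

definition apply_kraus ::
    "'v \<Rightarrow> 'r set set \<Rightarrow> 'r kraus list \<Rightarrow> ('v, 'r) density \<Rightarrow> ('v, 'r) density" where
  "apply_kraus v A Ks \<rho> x y =
     (\<Sum>K\<leftarrow>Ks. \<Sum>a\<in>A. \<Sum>b\<in>A. K (x v) a * \<rho> (x(v := a)) (y(v := b)) * cnj (K (y v) b))"

text \<open>
  Every classical outcome of an instrument has its own output space and a list of Kraus operators;
  several operators for one outcome describe a local loss of information.
\<close>

definition instrument :: "'r set set \<Rightarrow> ('r set set \<times> 'r kraus list) list \<Rightarrow> bool" where
  "instrument A I \<longleftrightarrow> (\<forall>(A', Ks) \<in> set I. finite A')
     \<and> (\<forall>a\<in>A. \<forall>b\<in>A.
          (\<Sum>(A', Ks)\<leftarrow>I. \<Sum>K\<leftarrow>Ks. \<Sum>c\<in>A'. cnj (K c a) * K c b) = of_bool (a = b))"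

text \<open>
  Each branch is a complete classical record known to all parties, so the acting party and its
  instrument may depend on it. The last rule forgets part of the record.
\<close>

inductive locc :: "'v set \<Rightarrow> ('v, 'r) branch \<Rightarrow> ('v, 'r) branch multiset \<Rightarrow> bool"
  for V :: "'v set" and S :: "('v, 'r) branch" where
  start: "locc V S {#S#}"
| local_step: "locc V S (add_mset (L, \<rho>) M) \<Longrightarrow> v \<in> V \<Longrightarrow> instrument (L v) I \<Longrightarrow>
    locc V S (M + mset (map (\<lambda>(A', Ks). (L(v := A'), apply_kraus v (L v) Ks \<rho>)) I))"
| forget: "locc V S (add_mset (L, \<rho>\<^sub>1) (add_mset (L, \<rho>\<^sub>2) M)) \<Longrightarrow>
    locc V S (add_mset (L, \<lambda>x y. \<rho>\<^sub>1 x y + \<rho>\<^sub>2 x y) M)"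

definition branch_prob :: "'v set \<Rightarrow> ('v, 'r) branch \<Rightarrow> real" where
  "branch_prob V = (\<lambda>(L, \<rho>). Re (\<Sum>x \<in> PiE V L. \<rho> x x))"

definition is_qubit :: "'r set set \<Rightarrow> 'r \<Rightarrow> bool" where
  "is_qubit A r \<longleftrightarrow> (\<forall>a\<in>A. insert r a \<in> A \<and> a - {r} \<in> A)"

definition set_register :: "'v set \<Rightarrow> 'r \<Rightarrow> bool \<Rightarrow> ('v \<Rightarrow> 'r set) \<Rightarrow> 'v \<Rightarrow> 'r set" where
  "set_register p r b x v =
     (if v \<in> p then (if b then insert r (x v) else x v - {r}) else x v)"

text \<open>
  Fidelity with \<open>|\<Phi>\<^sup>+\<rangle> = (|00\<rangle> + |11\<rangle>) / sqrt 2\<close> of the normalised reduced state of the two qubits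
  called \<open>r\<close> held by the two members of \<open>p\<close>.
\<close>

definition bell_fidelity :: "'v set \<Rightarrow> 'v set \<Rightarrow> 'r \<Rightarrow> ('v, 'r) branch \<Rightarrow> real" where
  "bell_fidelity V p r = (\<lambda>(L, \<rho>).
     Re (1 / 2 * (\<Sum>x \<in> {x \<in> PiE V L. \<forall>v\<in>p. r \<notin> x v}. \<Sum>b\<in>UNIV. \<Sum>c\<in>UNIV.
            \<rho> (set_register p r b x) (set_register p r c x)))
       / branch_prob V (L, \<rho>))"

text \<open>
  The output pairs for the session \<open>p\<close> are the pairs of equally named qubits of its two members;
  since renaming is a local operation, this fixes nothing but a convention.
\<close>

definition ideal_pairs :: "'v set \<Rightarrow> 'v set \<Rightarrow> ('v, 'r) branch \<Rightarrow> nat" where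
  "ideal_pairs V p = (\<lambda>(L, \<rho>).
     card {r. (\<forall>v\<in>p. is_qubit (L v) r) \<and> bell_fidelity V p r (L, \<rho>) = 1})"


subsection \<open>Final processing of the retained states\<close>

text \<open>
  One qubit register named \<open>p\<close> at either member of every unordered node pair \<open>p\<close>; these two qubits
  are in the state \<open>sqrt \<lambda> |00\<rangle> + sqrt (1 - \<lambda>) |11\<rangle>\<close>.
\<close>

definition retained_amplitude ::
    "real \<Rightarrow> 'v set \<Rightarrow> 'v set set \<Rightarrow> ('v \<Rightarrow> 'v set set) \<Rightarrow> complex" where
  "retained_amplitude \<theta> V E x = (\<Prod>p \<in> nsets V 2.
     if \<forall>v\<in>p. p \<notin> x v then of_real (sqrt (retained_schmidt \<theta> E p))
     else if \<forall>v\<in>p. p \<in> x v then of_real (sqrt (1 - retained_schmidt \<theta> E p))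
     else 0)"

definition retained_state :: "real \<Rightarrow> 'v set \<Rightarrow> 'v set set \<Rightarrow> ('v, 'v set) branch" where
  "retained_state \<theta> V E =
     (\<lambda>v. Pow {p \<in> nsets V 2. v \<in> p},
      \<lambda>x y. retained_amplitude \<theta> V E x * cnj (retained_amplitude \<theta> V E y))"

definition locc_rate ::
    "real \<Rightarrow> vertex set \<Rightarrow> vertex set set
      \<Rightarrow> (vertex set \<Rightarrow> (vertex, vertex set) branch multiset) \<Rightarrow> real" where
  "locc_rate a V E \<sigma> = 1 / real (min_window V E) *
     measure_pmf.expectation (pmf_of_set (nsets V 2))
       (\<lambda>p. \<Sum>b\<in>#\<sigma> p. branch_prob V b * (phys_dist a p * real (ideal_pairs V p b)))"

text \<open>
  A strategy \<open>\<sigma>\<close> may depend on the session. The supremum is taken in \<^typ>\<open>ereal\<close>, where it is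
  meaningful without a boundedness assumption.
\<close>

definition optimal_locc_rate :: "real \<Rightarrow> real \<Rightarrow> vertex set \<Rightarrow> vertex set set \<Rightarrow> ereal" where
  "optimal_locc_rate a \<theta> V E =
     (SUP \<sigma> \<in> {\<sigma>. \<forall>p \<in> nsets V 2. locc V (retained_state \<theta> V E) (\<sigma> p)}. ereal (locc_rate a V E \<sigma>))"

definition singlet_prob :: "real \<Rightarrow> 'v set set \<Rightarrow> 'v set \<Rightarrow> real" where
  "singlet_prob \<theta> E p = min 1 (2 * (1 - retained_schmidt \<theta> E p))"

definition bell_graph_pmf :: "real \<Rightarrow> 'v set \<Rightarrow> 'v set set \<Rightarrow> 'v set set pmf" where
  "bell_graph_pmf \<theta> V E = map_pmf (\<lambda>f. {p \<in> nsets V 2. f p})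
     (Pi_pmf (nsets V 2) False (\<lambda>p. bernoulli_pmf (singlet_prob \<theta> E p)))"

definition max_routing :: "'v set set \<Rightarrow> 'v set \<Rightarrow> nat" where
  "max_routing B p =
     Max {card F | F. F \<subseteq> {path_edges xs | xs. is_path B p xs} \<and> pairwise disjnt F}"

definition routing_rate :: "real \<Rightarrow> real \<Rightarrow> vertex set \<Rightarrow> vertex set set \<Rightarrow> real" where
  "routing_rate a \<theta> V E = 1 / real (min_window V E) *
     measure_pmf.expectation (pair_pmf (pmf_of_set (nsets V 2)) (bell_graph_pmf \<theta> V E))
       (\<lambda>(p, B). phys_dist a p * real (max_routing B p))"

end

theory Submission
  imports Defs
begin

text \<open>
  The window is the largest link load. It is at most exponential in \<open>sqrt N\<close> because a graph of
  degree three has at most \<open>N * 3 ^ h\<close> walks of length \<open>h\<close>, and at least exponential because two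
  opposite corners of the block of side \<open>m\<close> are joined by at least \<open>2 ^ m\<close> shortest paths with a common
  first edge.

  LOCC cannot raise the Schmidt number across the cut between one session node and the rest, which
  is at most \<open>2 ^ (N - 1)\<close> for the retained states, while \<open>k\<close> ideal pairs need Schmidt number
  \<open>2 ^ k\<close>. So every final processing has a payoff polynomial in \<open>N\<close>. Conversely a session that
  happens to be an edge yields a Bell pair with constant probability, by LOCC and by routing alike.
  Both rates are therefore \<open>1 / W\<close> up to polynomial factors.
\<close>


subsection \<open>Shortest paths and windows\<close>

text \<open>A protocol may be adaptive, of any length, with local spaces of any finite dimension,
  and may forget outcomes, so its outputs cannot be enumerated. What is followed is an invariant of
  a branch: its matrix is a mixture of vectors, each a sum of products over the cut indexed by one
  fixed set \<open>J\<close>. Local operators act on one side of every product and forgetting merges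
  two lists of vectors, so \<open>J\<close> never grows. Fidelity exactly 1 makes this sharp: it
  constrains every vector of the mixture and not only the average, so a single nonzero vector
  already carries all ideal pairs of its branch.

  Polynomial factors are harmless because \<open>ln N\<close> is negligible against
  \<open>sqrt N\<close>; hence distances, pair counts and session probabilities are bounded crudely
  throughout. An edge serves for the lower bounds because its conversion probability depends only on
  \<theta>, and a fixed pair is the session with probability at least
  \<open>1 / N ^ 2\<close>.\<close>

lemma path_edges_Cons: "path_edges (u # v # xs) = insert {u, v} (path_edges (v # xs))"
proof -
  have "path_edges (u # v # xs) = (\<lambda>i. {(u # v # xs) ! i, (u # v # xs) ! Suc i}) ` {..<Suc (length xs)}"
    by (auto simp: path_edges_def)
  moreover have "path_edges (v # xs) = (\<lambda>i. {(v # xs) ! i, (v # xs) ! Suc i}) ` {..<length xs}"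
    by (auto simp: path_edges_def)
  ultimately show ?thesis
    by (simp add: lessThan_Suc_eq_insert_0 image_image)
qed

lemma path_edges_singleton [simp]: "path_edges [u] = {}"
  by (simp add: path_edges_def)

lemma path_edges_subset:
  "successively (\<lambda>u v. {u, v} \<in> E) xs \<Longrightarrow> path_edges xs \<subseteq> E"
  by (auto simp: path_edges_def successively_conv_nth)

text \<open>Paths are stored as edge sets, and this recovers their vertices. A single vertex has no
  edges, hence the bound on the length.\<close>

lemma Union_path_edges:
  "2 \<le> length xs \<Longrightarrow> \<Union> (path_edges xs) = set xs"
proof (induction xs rule: induct_list012)
  case (3 u v xs)
  then show ?case
    by (cases xs) (auto simp: path_edges_Cons)
qed auto

lemma pairE:
  assumes "p \<in> nsets V 2"
  obtains u v where "p = {u, v}" "u \<noteq> v" "u \<in> V" "v \<in> V"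
  using assms by (auto simp: nsets_def card_2_iff)

lemma is_path_pair_length:
  assumes "is_path E p xs" "card p = 2"
  shows "2 \<le> length xs"
proof -
  have "length xs \<noteq> 0" "length xs \<noteq> 1"
    using assms by (auto simp: is_path_def length_Suc_conv)
  then show ?thesis by linarith
qed

lemma hop_dist_path:
  assumes "is_path E p xs"
  obtains ys where "is_path E p ys" "length ys = Suc (hop_dist E p)"
proof -
  have "\<exists>h ys. is_path E p ys \<and> length ys = Suc h"
    using assms by (intro exI[of _ "length xs - 1"] exI[of _ xs]) (auto simp: is_path_def)
  then have "\<exists>ys. is_path E p ys \<and> length ys = Suc (hop_dist E p)"
    unfolding hop_dist_def by (rule LeastI_ex)
  then show ?thesis using that by blast
qed

lemma hop_dist_le: "is_path E p xs \<Longrightarrow> length xs = Suc h \<Longrightarrow> hop_dist E p \<le> h"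
  unfolding hop_dist_def by (rule Least_le) blast

lemma shortest_paths_subset: "shortest_paths E p \<subseteq> Pow E"
  by (auto simp: shortest_paths_def is_path_def dest: path_edges_subset)

lemma finite_shortest_paths: "finite E \<Longrightarrow> finite (shortest_paths E p)"
  using finite_subset[OF shortest_paths_subset] by blast

lemma is_path_edge:
  assumes "u \<noteq> v" "{u, v} \<in> E"
  shows "is_path E {u, v} [u, v]"
  using assms by (simp add: is_path_def)

lemma hop_dist_edge:
  assumes "u \<noteq> v" "{u, v} \<in> E"
  shows "hop_dist E {u, v} = 1"
proof (rule antisym)
  show "hop_dist E {u, v} \<le> 1"
    using hop_dist_le[OF is_path_edge[OF assms]] by simp
  obtain ys where "is_path E {u, v} ys" "length ys = Suc (hop_dist E {u, v})"
    using hop_dist_path[OF is_path_edge[OF assms]] by blast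
  then show "1 \<le> hop_dist E {u, v}"
    using is_path_pair_length[of E "{u, v}" ys] assms by simp
qed

text \<open>Both vertex lists of length two have the same edge set, so counting edge sets gives
  exactly one path and neighbours retain the elementary state.\<close>

lemma shortest_paths_edge:
  assumes "u \<noteq> v" "{u, v} \<in> E"
  shows "shortest_paths E {u, v} = {{{u, v}}}"
proof -
  have "path_edges xs = {{u, v}}" if xs: "is_path E {u, v} xs" "length xs = 2" for xs
  proof -
    obtain x y where "xs = [x, y]"
      using xs(2) by (auto simp: numeral_2_eq_2 length_Suc_conv)
    then show ?thesis using xs by (simp add: is_path_def path_edges_Cons)
  qed
  moreover have "\<exists>xs. is_path E {u, v} xs \<and> length xs = 2"
    using is_path_edge[OF assms] by (intro exI[of _ "[u, v]"]) simp
  ultimately have "{path_edges xs | xs. is_path E {u, v} xs \<and> length xs = 2} = {{{u, v}}}"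
    by blast
  then show ?thesis
    by (simp add: shortest_paths_def hop_dist_edge[OF assms] numeral_2_eq_2)
qed

section \<open>Windows as injections of uses into slots\<close>

lemma finite_prescribed_uses:
  assumes "finite V" "finite E"
  shows "finite (prescribed_uses V E)"
proof (rule finite_subset)
  show "prescribed_uses V E \<subseteq> nsets V 2 \<times> Pow E \<times> E"
    unfolding prescribed_uses_def using shortest_paths_subset[of E] by blast
  show "finite (nsets V 2 \<times> Pow E \<times> E)"
    using assms by (simp add: finite_imp_finite_nsets)
qed

text \<open>The double sum counts the fibre over \<open>e\<close> of the projection of uses to
  links; cardinalities of fibres are what decides whether injections exist.\<close>

lemma link_load_eq_card:
  assumes "finite V" "finite E"
  shows "link_load V E e = card {u \<in> prescribed_uses V E. snd (snd u) = e}"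
proof -
  have fin: "finite (nsets V 2)" using assms by (simp add: finite_imp_finite_nsets)
  have "{u \<in> prescribed_uses V E. snd (snd u) = e} =
      (\<lambda>(p, P). (p, P, e)) ` (SIGMA p : nsets V 2. {P \<in> shortest_paths E p. e \<in> P})"
    by (force simp: prescribed_uses_def)
  then have "card {u \<in> prescribed_uses V E. snd (snd u) = e} =
      card (SIGMA p : nsets V 2. {P \<in> shortest_paths E p. e \<in> P})"
    by (simp add: card_image inj_on_def split_def prod_eq_iff)
  also have "\<dots> = link_load V E e"
    using fin finite_shortest_paths[OF assms(2)]
    by (simp add: link_load_def card_SigmaI of_bool_def sum.If_cases Int_def)
  finally show ?thesis ..
qed

text \<open>A copy serves only its own link, so an injective assignment is a family of independent
  injections, one for each link, from the uses of that link into \<open>w\<close> slots.\<close>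

lemma window_supplies_iff:
  assumes "finite V" "finite E"
  shows "window_supplies V E w \<longleftrightarrow> (\<forall>e\<in>E. link_load V E e \<le> w)"
proof
  assume "window_supplies V E w"
  then obtain f where f: "inj_on f (prescribed_uses V E)"
    "\<And>u. u \<in> prescribed_uses V E \<Longrightarrow> f u \<in> {snd (snd u)} \<times> {..<w}"
    unfolding window_supplies_def by fastforce
  show "\<forall>e\<in>E. link_load V E e \<le> w"
  proof
    fix e
    have "f ` {u \<in> prescribed_uses V E. snd (snd u) = e} \<subseteq> {e} \<times> {..<w}"
      using f(2) by blast
    then have "card {u \<in> prescribed_uses V E. snd (snd u) = e} \<le> card ({e} \<times> {..<w})"
      using f(1) by (intro card_inj_on_le[of f]) (auto simp: inj_on_def)
    then show "link_load V E e \<le> w"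
      using link_load_eq_card[OF assms] by (simp add: card_cartesian_product)
  qed
next
  assume load: "\<forall>e\<in>E. link_load V E e \<le> w"
  let ?U = "\<lambda>e. {u \<in> prescribed_uses V E. snd (snd u) = e}"
  have "\<forall>e\<in>E. \<exists>g. inj_on g (?U e) \<and> g ` ?U e \<subseteq> {..<w}"
  proof
    fix e assume "e \<in> E"
    then have "card (?U e) \<le> card {..<w}"
      using load link_load_eq_card[OF assms] by auto
    then show "\<exists>g. inj_on g (?U e) \<and> g ` ?U e \<subseteq> {..<w}"
      using card_le_inj[of "?U e" "{..<w}"] finite_prescribed_uses[OF assms] by auto
  qed
  from bchoice[OF this]
  obtain g where g: "\<And>e. e \<in> E \<Longrightarrow> inj_on (g e) (?U e)"
      "\<And>e. e \<in> E \<Longrightarrow> g e ` ?U e \<subseteq> {..<w}"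
    by blast
  have E: "snd (snd u) \<in> E" if u: "u \<in> prescribed_uses V E" for u
  proof -
    obtain p P e where "u = (p, P, e)" "P \<in> shortest_paths E p" "e \<in> P"
      using u unfolding prescribed_uses_def by blast
    then show ?thesis using shortest_paths_subset[of E p] by auto
  qed
  \<comment> \<open>Tagging the slot with its link keeps uses of different links apart, so
    injectivity on each fibre is enough.\<close>
  define f where "f u = (snd (snd u), g (snd (snd u)) u)" for u
  have "inj_on f (prescribed_uses V E)"
  proof (rule inj_onI)
    fix u v assume uv: "u \<in> prescribed_uses V E" "v \<in> prescribed_uses V E" "f u = f v"
    then have "u \<in> ?U (snd (snd u))" "v \<in> ?U (snd (snd u))" by (auto simp: f_def)
    moreover have "g (snd (snd u)) u = g (snd (snd u)) v"
      using uv(3) unfolding f_def prod.inject by metis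
    ultimately show "u = v" using inj_onD[OF g(1)[OF E[OF uv(1)]]] by blast
  qed
  moreover have "\<forall>(p, P, e) \<in> prescribed_uses V E. f (p, P, e) \<in> {e} \<times> {..<w}"
  proof clarify
    fix p P e assume u: "(p, P, e) \<in> prescribed_uses V E"
    then have "(p, P, e) \<in> ?U e" "e \<in> E" using E[OF u] by simp_all
    then have "g e (p, P, e) \<in> {..<w}" using g(2)[of e] by blast
    then show "f (p, P, e) \<in> {e} \<times> {..<w}" by (simp add: f_def)
  qed
  ultimately show "window_supplies V E w"
    unfolding window_supplies_def by blast
qed

lemma min_window_eq_Max:
  assumes "finite V" "finite E" "E \<noteq> {}"
  shows "min_window V E = Max (link_load V E ` E)"
  unfolding min_window_def window_supplies_iff[OF assms(1,2)]
  using assms by (intro Least_equality) auto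

section \<open>Upper bounds on numbers of walks, of shortest paths and on the load\<close>

lemma card_neighbours_le:
  assumes "finite E" "card {e \<in> E. v \<in> e} \<le> D"
  shows "finite {w. {w, v} \<in> E}" "card {w. {w, v} \<in> E} \<le> D"
proof -
  have inj: "inj_on (\<lambda>w. {w, v}) {w. {w, v} \<in> E}"
    by (auto simp: inj_on_def doubleton_eq_iff)
  have sub: "(\<lambda>w. {w, v}) ` {w. {w, v} \<in> E} \<subseteq> {e \<in> E. v \<in> e}"
    by auto
  show "finite {w. {w, v} \<in> E}"
    using inj_on_finite[OF inj sub] assms by simp
  show "card {w. {w, v} \<in> E} \<le> D"
    using card_inj_on_le[OF inj sub] assms by simp
qed

text \<open>Walks instead of paths: without distinctness a longer walk is just a shorter one with a
  neighbour of its head put in front, at most \<open>D\<close> choices. Finiteness is carried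
  through the same induction because the cardinality steps depend on it.\<close>

lemma card_walks_le:
  assumes "finite V" "finite E" "\<And>v. v \<in> V \<Longrightarrow> card {e \<in> E. v \<in> e} \<le> D"
  shows "finite {xs. length xs = Suc h \<and> set xs \<subseteq> V \<and> successively (\<lambda>u v. {u, v} \<in> E) xs}
    \<and> card {xs. length xs = Suc h \<and> set xs \<subseteq> V \<and> successively (\<lambda>u v. {u, v} \<in> E) xs} \<le> card V * D ^ h"
    (is "finite (?A h) \<and> _")
proof (induction h)
  case 0
  have "?A 0 = (\<lambda>v. [v]) ` V" by (auto simp: length_Suc_conv)
  then show ?case using assms(1) by (auto simp: card_image inj_on_def)
next
  case (Suc h)
  let ?N = "\<lambda>v. {w. {w, v} \<in> E}"
  let ?B = "SIGMA ys : ?A h. ?N (hd ys)"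
  have sub: "?A (Suc h) \<subseteq> (\<lambda>(ys, w). w # ys) ` ?B"
  proof
    fix xs assume "xs \<in> ?A (Suc h)"
    then obtain w ys where "xs = w # ys" "length ys = Suc h" "set ys \<subseteq> V"
      "successively (\<lambda>u v. {u, v} \<in> E) ys" "{w, hd ys} \<in> E"
      by (auto simp: length_Suc_conv)
    then show "xs \<in> (\<lambda>(ys, w). w # ys) ` ?B" by force
  qed
  have hd: "hd ys \<in> V" if "ys \<in> ?A h" for ys
    using that by (cases ys) auto
  have fin: "finite ?B"
    using Suc card_neighbours_le(1)[OF assms(2,3)] hd by (intro finite_SigmaI) blast+
  have "card ?B = (\<Sum>ys\<in>?A h. card (?N (hd ys)))"
    using Suc card_neighbours_le(1)[OF assms(2,3)] hd by (intro card_SigmaI) blast+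
  also have "\<dots> \<le> (\<Sum>ys\<in>?A h. D)"
    using card_neighbours_le(2)[OF assms(2,3)] hd by (intro sum_mono) blast
  also have "\<dots> \<le> card V * D ^ h * D"
    using Suc by simp
  finally have "card ?B \<le> card V * D ^ Suc h" by (simp only: power_Suc mult_ac)
  moreover have "card (?A (Suc h)) \<le> card ?B"
    using card_mono[OF finite_imageI[OF fin] sub] card_image_le[OF fin, of "\<lambda>(ys, w). w # ys"]
    by linarith
  ultimately show ?case
    using finite_subset[OF sub finite_imageI[OF fin]] by simp
qed

lemma is_path_subset:
  assumes "E \<subseteq> nsets V 2" "is_path E p xs" "card p = 2"
  shows "set xs \<subseteq> V"
proof -
  have "set xs = \<Union> (path_edges xs)"
    using Union_path_edges is_path_pair_length[OF assms(2,3)] by blast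
  also have "\<dots> \<subseteq> \<Union> E"
    using path_edges_subset[of E xs] assms(2) by (auto simp: is_path_def)
  also have "\<dots> \<subseteq> V"
    using assms(1) by (auto simp: nsets_def)
  finally show ?thesis .
qed

lemma card_shortest_paths_le:
  assumes "finite V" "E \<subseteq> nsets V 2" "\<And>v. v \<in> V \<Longrightarrow> card {e \<in> E. v \<in> e} \<le> D" "card p = 2"
  shows "card (shortest_paths E p) \<le> card V * D ^ hop_dist E p"
proof -
  let ?A = "{xs. length xs = Suc (hop_dist E p) \<and> set xs \<subseteq> V \<and> successively (\<lambda>u v. {u, v} \<in> E) xs}"
  have fin: "finite E"
    using assms(1,2) by (meson finite_imp_finite_nsets finite_subset)
  note A = card_walks_le[OF assms(1) fin assms(3), of "hop_dist E p"]
  have "shortest_paths E p \<subseteq> path_edges ` ?A"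
    using is_path_subset[OF assms(2) _ assms(4)] by (auto simp: shortest_paths_def is_path_def)
  then have "card (shortest_paths E p) \<le> card (path_edges ` ?A)"
    using A by (intro card_mono) auto
  also have "\<dots> \<le> card ?A"
    using A by (intro card_image_le) auto
  finally show ?thesis using A by linarith
qed

text \<open>Every shortest path of every pair is charged to \<open>e\<close>, whether or not it
  contains \<open>e\<close>. With \<open>0 < D\<close> the power is monotone, which replaces the
  individual hop distances by \<open>h\<close>.\<close>

lemma link_load_le:
  assumes "finite V" "E \<subseteq> nsets V 2" "\<And>v. v \<in> V \<Longrightarrow> card {e \<in> E. v \<in> e} \<le> D" "0 < D"
    and "\<And>p. p \<in> nsets V 2 \<Longrightarrow> hop_dist E p \<le> h"
  shows "link_load V E e \<le> card (nsets V 2) * (card V * D ^ h)"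
proof -
  have fin: "finite E"
    using assms(1,2) by (meson finite_imp_finite_nsets finite_subset)
  have "link_load V E e \<le> (\<Sum>p \<in> nsets V 2. card V * D ^ h)"
    unfolding link_load_def
  proof (rule sum_mono)
    fix p assume p: "p \<in> nsets V 2"
    have "(\<Sum>P \<in> shortest_paths E p. of_bool (e \<in> P)) \<le> (\<Sum>P \<in> shortest_paths E p. 1 :: nat)"
      by (intro sum_mono) auto
    also have "\<dots> = card (shortest_paths E p)" by simp
    also have "\<dots> \<le> card V * D ^ hop_dist E p"
      using card_shortest_paths_le[OF assms(1-3)] p by (auto simp: nsets_def)
    also have "\<dots> \<le> card V * D ^ h"
      using assms(4) assms(5)[OF p] by (intro mult_left_mono power_increasing) auto
    finally show "(\<Sum>P \<in> shortest_paths E p. of_bool (e \<in> P)) \<le> card V * D ^ h" .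
  qed
  then show ?thesis by simp
qed

lemma link_load_ge:
  assumes "finite V" "finite E" "p \<in> nsets V 2" "S \<subseteq> shortest_paths E p" "\<And>P. P \<in> S \<Longrightarrow> e \<in> P"
  shows "card S \<le> link_load V E e"
proof -
  have fin: "finite (nsets V 2)" using assms by (simp add: finite_imp_finite_nsets)
  have "card S = (\<Sum>P\<in>S. of_bool (e \<in> P))"
    using assms(5) by simp
  also have "\<dots> \<le> (\<Sum>P \<in> shortest_paths E p. of_bool (e \<in> P))"
    using assms(4) finite_shortest_paths[OF assms(2)] by (intro sum_mono2) auto
  also have "\<dots> \<le> link_load V E e"
    unfolding link_load_def using assms(3) fin
    by (intro member_le_sum[where f = "\<lambda>p. \<Sum>P \<in> shortest_paths E p. of_bool (e \<in> P)"]) auto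
  finally show ?thesis .
qed


subsection \<open>Exponentially many shortest paths\<close>

text \<open>A height that changes by exactly one along every edge of the honeycomb lattice; the paths
  below are shortest because they climb by one in each hop.\<close>

definition height :: "vertex \<Rightarrow> int" where
  "height = (\<lambda>(i, j, s). 2 * (i + j) + of_bool s)"

lemma height_edge: "{u, v} \<in> honeycomb_edges \<Longrightarrow> \<bar>height u - height v\<bar> = 1"
  by (auto simp: honeycomb_edges_def height_def doubleton_eq_iff)

lemma height_path:
  assumes "successively (\<lambda>u v. {u, v} \<in> honeycomb_edges) xs" "xs \<noteq> []"
  shows "\<bar>height (hd xs) - height (last xs)\<bar> < int (length xs)"
  using assms
proof (induction xs rule: induct_list012)
  case (3 u v xs)
  then show ?case using height_edge[of u v] by auto
qed auto

text \<open>Each bit chooses one of the two ways around a hexagon, three hops from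
  \<open>(i, j, True)\<close> to the opposite vertex \<open>(i + 1, j + 1, False)\<close>; a fourth
  hop leads to the start of the next hexagon on the diagonal. All choices are independent.\<close>

fun staircase :: "int \<Rightarrow> int \<Rightarrow> bool list \<Rightarrow> vertex list" where
  "staircase i j [] = [(i, j, True)]"
| "staircase i j (b # bs) = (i, j, True)
     # (if b then (i + 1, j, False) else (i, j + 1, False))
     # (if b then (i + 1, j, True) else (i, j + 1, True))
     # (i + 1, j + 1, False) # staircase (i + 1) (j + 1) bs"

lemma staircase_not_Nil [simp]: "staircase i j bs \<noteq> []"
  by (cases bs) auto

lemma hd_staircase [simp]: "hd (staircase i j bs) = (i, j, True)"
  by (cases bs) auto

lemma last_staircase:
  "last (staircase i j bs) = (i + int (length bs), j + int (length bs), True)"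
  by (induction bs arbitrary: i j) auto

lemma length_staircase: "length (staircase i j bs) = Suc (4 * length bs)"
  by (induction bs arbitrary: i j) auto

lemma staircase_inj:
  "staircase i j bs = staircase i j cs \<Longrightarrow> bs = cs"
proof (induction bs arbitrary: i j cs)
  case Nil
  then show ?case by (cases cs) auto
next
  case (Cons b bs)
  then show ?case by (cases cs) (auto split: if_splits)
qed

text \<open>The heights are consecutive integers and do not depend on the bits. This yields
  distinctness of the vertices and later allows a path to be rebuilt from its unordered vertex
  set.\<close>

lemma map_height_staircase:
  "map height (staircase i j bs) = map (\<lambda>k. 2 * (i + j) + 1 + int k) [0..<length (staircase i j bs)]"
proof (induction bs arbitrary: i j)
  case (Cons b bs)
  show ?case
    by (simp only: staircase.simps list.map Cons.IH length_Cons upt_conv_Cons zero_less_Suc)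
      (simp add: height_def map_Suc_upt[symmetric] del: upt_Suc)
qed (simp add: height_def)

lemma staircase_subset:
  "set (staircase i j bs) \<subseteq> {i..i + int (length bs)} \<times> {j..j + int (length bs)} \<times> UNIV"
proof (induction bs arbitrary: i j)
  case (Cons b bs)
  have "{i + 1..i + 1 + int (length bs)} \<times> {j + 1..j + 1 + int (length bs)} \<times> UNIV
      \<subseteq> {i..i + int (length (b # bs))} \<times> {j..j + int (length (b # bs))} \<times> (UNIV :: bool set)"
    by auto
  with Cons[of "i + 1" "j + 1"] show ?case by auto
qed auto

lemma successively_staircase:
  "successively (\<lambda>u v. {u, v} \<in> honeycomb_edges) (staircase i j bs)"
proof (induction bs arbitrary: i j)
  case (Cons b bs)
  then show ?case
    by (auto simp: successively_Cons honeycomb_edges_def doubleton_eq_iff)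
qed simp


text \<open>The end points differ in height by \<open>4 * m + 1\<close>, and no edge changes the
  height by more than one, so the staircases are shortest whatever further honeycomb edges
  \<open>E\<close> has. The vertex \<open>(i, j, False)\<close> is put in front so that all of them
  pass through the one edge \<open>e\<close>.\<close>

lemma exponential_link_load:
  assumes "finite V" "E \<subseteq> honeycomb_edges \<inter> nsets V 2"
    and block: "coord_block i j m \<subseteq> V" "honeycomb_edges \<inter> nsets (coord_block i j m) 2 \<subseteq> E"
  obtains e where "e \<in> E" "2 ^ m \<le> link_load V E e"
proof -
  define xs where "xs bs = (i, j, False) # staircase i j bs" for bs
  define p where "p = {(i, j, False), (i + int m, j + int m, True)}"
  define e where "e = {(i, j, False), (i, j, True)}"
  have finE: "finite E"
    using assms(1,2) by (meson finite_imp_finite_nsets finite_subset le_inf_iff)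
  have height_xs: "map height (xs bs) = map (\<lambda>k. 2 * (i + j) + int k) [0..<Suc (length (staircase i j bs))]"
    for bs
    unfolding xs_def list.map map_height_staircase
    by (simp only: upt_conv_Cons zero_less_Suc list.map)
      (simp add: height_def map_Suc_upt[symmetric] del: upt_Suc)
  have dist: "distinct (map height (xs bs))" for bs
    unfolding height_xs by (simp add: distinct_map inj_on_def del: upt_Suc)
  have path: "is_path E p (xs bs)" if bs: "length bs = m" for bs
    unfolding is_path_def
  proof (intro conjI)
    show "xs bs \<noteq> []" by (simp add: xs_def)
    show "distinct (xs bs)" using dist distinct_map by blast
    show "{hd (xs bs), last (xs bs)} = p"
      using bs by (simp add: xs_def last_staircase p_def)
    have sub: "set (xs bs) \<subseteq> coord_block i j m"
      using staircase_subset[of i j bs] bs by (auto simp: xs_def coord_block_def)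
    have "successively (\<lambda>u v. {u, v} \<in> honeycomb_edges) (xs bs)"
      using successively_staircase[of i j bs]
      by (auto simp: xs_def successively_Cons honeycomb_edges_def doubleton_eq_iff)
    then show "successively (\<lambda>u v. {u, v} \<in> E) (xs bs)"
    proof (rule successively_mono)
      fix u v assume uv: "u \<in> set (xs bs)" "v \<in> set (xs bs)" "{u, v} \<in> honeycomb_edges"
      then have "u \<noteq> v" using height_edge[of u v] by auto
      then have "{u, v} \<in> nsets (coord_block i j m) 2"
        using sub uv(1,2) by (auto simp: nsets_def)
      then show "{u, v} \<in> E" using uv(3) block(2) by blast
    qed
  qed
  have len: "length (xs bs) = Suc (4 * m + 1)" if "length bs = m" for bs
    using that by (simp add: xs_def length_staircase)
  have hop: "hop_dist E p = 4 * m + 1"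
  proof (rule antisym)
    have r: "length (replicate m True) = m" by simp
    show "hop_dist E p \<le> 4 * m + 1"
      using hop_dist_le[OF path[OF r] len[OF r]] .
    obtain ys where ys: "is_path E p ys" "length ys = Suc (hop_dist E p)"
      using hop_dist_path[OF path[OF r]] by blast
    have "successively (\<lambda>u v. {u, v} \<in> honeycomb_edges) ys"
      using ys(1) assms(2) by (auto simp: is_path_def elim!: successively_mono)
    then have "\<bar>height (hd ys) - height (last ys)\<bar> < int (length ys)"
      using ys(1) by (intro height_path) (auto simp: is_path_def)
    moreover have "{hd ys, last ys} = p" using ys(1) by (simp add: is_path_def)
    then have "\<bar>height (hd ys) - height (last ys)\<bar> = 4 * int m + 1"
      by (auto simp: p_def doubleton_eq_iff height_def)
    ultimately show "4 * m + 1 \<le> hop_dist E p"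
      using ys(2) by linarith
  qed
  have set_eq: "\<Union> (path_edges (xs bs)) = set (xs bs)" for bs
    by (rule Union_path_edges) (simp add: xs_def length_staircase)
  \<comment> \<open>Different bit lists must give different edge sets. The edge set determines the
    vertex set, and the height, injective along a path, determines the order; the list and hence the
    bits follow.\<close>
  have inj: "inj_on (\<lambda>bs. path_edges (xs bs)) {bs. length bs = m}"
  proof (rule inj_onI)
    fix bs cs assume *: "bs \<in> {bs. length bs = m}" "cs \<in> {bs. length bs = m}"
      "path_edges (xs bs) = path_edges (xs cs)"
    then have "set (xs bs) = set (xs cs)" using set_eq by metis
    moreover have "map height (xs bs) = map height (xs cs)"
      using * by (simp only: height_xs length_staircase mem_Collect_eq)
    moreover have "inj_on height (set (xs bs))" using dist[of bs] distinct_map by blast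
    ultimately have "xs bs = xs cs"
      using inj_on_map_eq_map[of height "xs bs" "xs cs"] by simp
    then show "bs = cs" using staircase_inj by (auto simp: xs_def)
  qed
  define S where "S = (\<lambda>bs. path_edges (xs bs)) ` {bs. length bs = m}"
  have "card S = card {bs :: bool list. set bs \<subseteq> UNIV \<and> length bs = m}"
    unfolding S_def using card_image[OF inj] by simp
  then have card_S: "card S = 2 ^ m"
    by (subst (asm) card_lists_length_eq) auto
  have S: "S \<subseteq> shortest_paths E p"
    using path len hop by (fastforce simp: S_def shortest_paths_def)
  have e: "e \<in> P" if "P \<in> S" for P
  proof -
    obtain bs where "P = path_edges (xs bs)" using \<open>P \<in> S\<close> by (auto simp: S_def)
    then show ?thesis by (cases bs) (auto simp: xs_def path_edges_Cons e_def)
  qed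
  have "card p = 2" by (simp add: p_def)
  moreover have "p \<subseteq> V" using block(1) by (auto simp: p_def coord_block_def)
  ultimately have "p \<in> nsets V 2"
    using finite_subset[OF _ assms(1)] by (auto simp: nsets_def)
  then have "2 ^ m \<le> link_load V E e"
    using link_load_ge[OF assms(1) finE _ S e] card_S by simp
  moreover have "S \<noteq> {}" using card_S by force
  then have "e \<in> E" using e S shortest_paths_subset[of E p] by blast
  ultimately show ?thesis using that by blast
qed


subsection \<open>Schmidt number under LOCC\<close>

lemma sum_list_sum_swap:
  "(\<Sum>i\<leftarrow>I. \<Sum>a\<in>A. f i a) = (\<Sum>a\<in>A. \<Sum>i\<leftarrow>I. f i a :: 'a :: comm_monoid_add)"
  by (induction I) (simp_all add: sum.distrib)

lemma sum_PiE_remove: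
  assumes "v \<in> V"
  shows "(\<Sum>x\<in>PiE V L. f x) = (\<Sum>x\<in>PiE (V - {v}) L. \<Sum>a\<in>L v. f (x(v := a)))"
proof -
  have "PiE V L = (\<lambda>(a, x). x(v := a)) ` (L v \<times> PiE (V - {v}) L)"
    using PiE_insert_eq[of v "V - {v}" L] assms by (simp add: insert_absorb)
  then have "(\<Sum>x\<in>PiE V L. f x) = (\<Sum>x\<in>(\<lambda>(a, x). x(v := a)) ` (L v \<times> PiE (V - {v}) L). f x)"
    by (simp only:)
  also have "\<dots> = (\<Sum>(a, x)\<in>L v \<times> PiE (V - {v}) L. f (x(v := a)))"
    by (subst sum.reindex[OF inj_combinator, of v "V - {v}"]) (simp_all add: case_prod_unfold)
  also have "\<dots> = (\<Sum>a\<in>L v. \<Sum>x\<in>PiE (V - {v}) L. f (x(v := a)))"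
    by (rule sum.cartesian_product[symmetric])
  finally show ?thesis by (simp add: sum.swap[of _ "L v"])
qed

lemma PiE_update:
  assumes "x \<in> PiE V (L(v := A))" "a \<in> L v" "v \<in> V"
  shows "x(v := a) \<in> PiE V L"
  using assms by (auto simp: PiE_iff extensional_def split: if_splits)

lemma PiE_update_same:
  assumes "x \<in> PiE V L" "a \<in> L v" "v \<in> V"
  shows "x(v := a) \<in> PiE V L"
  using assms by (auto simp: PiE_iff extensional_def)

text \<open>Cyclicity of the trace in coordinates: the Kraus operators enter only through the sum of
  \<open>K\<close> adjoint times \<open>K\<close>, which is what the completeness relation of an
  instrument speaks about.\<close>

lemma trace_apply_kraus:
  assumes "finite V" "v \<in> V"
  shows "(\<Sum>x\<in>PiE V (L(v := A)). apply_kraus v (L v) Ks \<rho> x x) =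
    (\<Sum>x\<in>PiE (V - {v}) L. \<Sum>a\<in>L v. \<Sum>b\<in>L v. \<rho> (x(v := a)) (x(v := b)) *
      (\<Sum>K\<leftarrow>Ks. \<Sum>c\<in>A. cnj (K c b) * K c a))"
proof -
  have "PiE (V - {v}) (L(v := A)) = PiE (V - {v}) L"
    by (rule PiE_cong) simp
  then have "(\<Sum>x\<in>PiE V (L(v := A)). apply_kraus v (L v) Ks \<rho> x x) =
    (\<Sum>x\<in>PiE (V - {v}) L. \<Sum>c\<in>A. \<Sum>K\<leftarrow>Ks. \<Sum>a\<in>L v. \<Sum>b\<in>L v.
        K c a * \<rho> (x(v := a)) (x(v := b)) * cnj (K c b))"
    by (simp add: sum_PiE_remove[OF assms(2), of _ "L(v := A)"] apply_kraus_def)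
  also have "\<dots> = (\<Sum>x\<in>PiE (V - {v}) L. \<Sum>a\<in>L v. \<Sum>b\<in>L v. \<Sum>K\<leftarrow>Ks. \<Sum>c\<in>A.
        K c a * \<rho> (x(v := a)) (x(v := b)) * cnj (K c b))"
  proof (rule sum.cong[OF refl])
    fix x
    let ?t = "\<lambda>c K a b. K c a * \<rho> (x(v := a)) (x(v := b)) * cnj (K c b)"
    have "(\<Sum>c\<in>A. \<Sum>K\<leftarrow>Ks. \<Sum>a\<in>L v. \<Sum>b\<in>L v. ?t c K a b) =
        (\<Sum>K\<leftarrow>Ks. \<Sum>c\<in>A. \<Sum>a\<in>L v. \<Sum>b\<in>L v. ?t c K a b)"
      by (rule sum_list_sum_swap[symmetric])
    also have "\<dots> = (\<Sum>K\<leftarrow>Ks. \<Sum>a\<in>L v. \<Sum>c\<in>A. \<Sum>b\<in>L v. ?t c K a b)"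
      by (simp only: sum.swap[of _ "L v" A])
    also have "\<dots> = (\<Sum>K\<leftarrow>Ks. \<Sum>a\<in>L v. \<Sum>b\<in>L v. \<Sum>c\<in>A. ?t c K a b)"
      by (simp only: sum.swap[of _ "L v" A])
    also have "\<dots> = (\<Sum>a\<in>L v. \<Sum>b\<in>L v. \<Sum>K\<leftarrow>Ks. \<Sum>c\<in>A. ?t c K a b)"
      by (simp only: sum_list_sum_swap)
    finally show "(\<Sum>c\<in>A. \<Sum>K\<leftarrow>Ks. \<Sum>a\<in>L v. \<Sum>b\<in>L v. ?t c K a b) =
        (\<Sum>a\<in>L v. \<Sum>b\<in>L v. \<Sum>K\<leftarrow>Ks. \<Sum>c\<in>A. ?t c K a b)" .
  qed
  also have "\<dots> = (\<Sum>x\<in>PiE (V - {v}) L. \<Sum>a\<in>L v. \<Sum>b\<in>L v. \<rho> (x(v := a)) (x(v := b)) *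
      (\<Sum>K\<leftarrow>Ks. \<Sum>c\<in>A. cnj (K c b) * K c a))"
    by (simp add: sum_list_const_mult[symmetric] sum_distrib_left mult_ac)
  finally show ?thesis .
qed

lemma trace_instrument:
  assumes "finite V" "v \<in> V" "finite (L v)" "instrument (L v) I"
  shows "(\<Sum>(A, Ks)\<leftarrow>I. branch_prob V (L(v := A), apply_kraus v (L v) Ks \<rho>)) = branch_prob V (L, \<rho>)"
proof -
  let ?G = "\<lambda>A Ks a b. \<Sum>K\<leftarrow>Ks. \<Sum>c\<in>A. cnj (K c b) * K c a"
  have "(\<Sum>(A, Ks)\<leftarrow>I. \<Sum>x\<in>PiE V (L(v := A)). apply_kraus v (L v) Ks \<rho> x x) =
    (\<Sum>i\<leftarrow>I. \<Sum>x\<in>PiE (V - {v}) L. \<Sum>a\<in>L v. \<Sum>b\<in>L v. \<rho> (x(v := a)) (x(v := b)) *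
      ?G (fst i) (snd i) a b)"
    by (simp add: trace_apply_kraus[OF assms(1,2)] case_prod_unfold)
  also have "\<dots> = (\<Sum>x\<in>PiE (V - {v}) L. \<Sum>a\<in>L v. \<Sum>b\<in>L v. \<rho> (x(v := a)) (x(v := b)) *
      (\<Sum>i\<leftarrow>I. ?G (fst i) (snd i) a b))"
    by (simp only: sum_list_sum_swap sum_list_const_mult)
  also have "\<dots> = (\<Sum>x\<in>PiE (V - {v}) L. \<Sum>a\<in>L v. \<Sum>b\<in>L v. \<rho> (x(v := a)) (x(v := b)) *
      of_bool (b = a))"
    using assms(4) by (intro sum.cong refl) (simp add: instrument_def case_prod_unfold)
  also have "\<dots> = (\<Sum>x\<in>PiE (V - {v}) L. \<Sum>a\<in>L v. \<rho> (x(v := a)) (x(v := a)))"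
    using assms(3) by (simp add: of_bool_def if_distrib cong: if_cong)
  also have "\<dots> = (\<Sum>x\<in>PiE V L. \<rho> x x)"
    by (simp add: sum_PiE_remove[OF assms(2)])
  finally have *: "(\<Sum>(A, Ks)\<leftarrow>I. \<Sum>x\<in>PiE V (L(v := A)). apply_kraus v (L v) Ks \<rho> x x) =
      (\<Sum>x\<in>PiE V L. \<rho> x x)" .
  have Re: "Re (sum_list (map g I)) = sum_list (map (\<lambda>i. Re (g i)) I)" for g
    by (induction I) simp_all
  show ?thesis
    using arg_cong[OF *, of Re] by (simp add: branch_prob_def Re case_prod_unfold)
qed

text \<open>The label of \<open>s\<close> is overwritten by the dummy \<open>{}\<close>, which need
  not be a label of \<open>s\<close>, so that \<open>g\<close> sees the other parties only. The
  index set consists of sets of registers so that the label set of \<open>s\<close> itself can serve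
  as \<open>J\<close>.\<close>

definition schmidt_factors ::
    "'v set \<Rightarrow> 'v \<Rightarrow> 'r set set \<Rightarrow> ('v, 'r) spaces \<Rightarrow> (('v \<Rightarrow> 'r set) \<Rightarrow> complex) \<Rightarrow> bool" where
  "schmidt_factors V s J L \<psi> \<longleftrightarrow>
     (\<exists>f g. \<forall>x\<in>PiE V L. \<psi> x = (\<Sum>j\<in>J. f j (x s) * g j (x(s := {}))))"

text \<open>An ensemble decomposition into unnormalised vectors; it also encodes positivity of the
  matrix. Only joint labels in \<open>PiE V (fst b)\<close> are constrained, since entries elsewhere
  have no meaning.\<close>

definition pure_mixture ::
    "'v set \<Rightarrow> ('v, 'r) branch \<Rightarrow> (('v \<Rightarrow> 'r set) \<Rightarrow> complex) list \<Rightarrow> bool" where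
  "pure_mixture V b \<Psi> \<longleftrightarrow> (\<forall>x\<in>PiE V (fst b). \<forall>y\<in>PiE V (fst b).
     snd b x y = (\<Sum>\<psi>\<leftarrow>\<Psi>. \<psi> x * cnj (\<psi> y)))"

text \<open>The Schmidt number across the cut \<open>s\<close> versus the rest is at most \<open>card J\<close>.\<close>

definition schmidt_bounded :: "'v set \<Rightarrow> 'v \<Rightarrow> 'r set set \<Rightarrow> ('v, 'r) branch \<Rightarrow> bool" where
  "schmidt_bounded V s J b \<longleftrightarrow>
     (\<exists>\<Psi>. pure_mixture V b \<Psi> \<and> (\<forall>\<psi>\<in>set \<Psi>. schmidt_factors V s J (fst b) \<psi>))"

definition kraus_vector ::
    "'v \<Rightarrow> 'r set set \<Rightarrow> 'r kraus \<Rightarrow> (('v \<Rightarrow> 'r set) \<Rightarrow> complex) \<Rightarrow> ('v \<Rightarrow> 'r set) \<Rightarrow> complex" where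
  "kraus_vector v A K \<psi> x = (\<Sum>a\<in>A. K (x v) a * \<psi> (x(v := a)))"

text \<open>A local operator touches one side of the cut: at \<open>s\<close> it is absorbed into
  each \<open>f j\<close>, at any other party into each \<open>g j\<close>. The index set is
  unchanged in both cases.\<close>

lemma schmidt_factors_kraus_vector:
  assumes "schmidt_factors V s J L \<psi>" "v \<in> V"
  shows "schmidt_factors V s J (L(v := A)) (kraus_vector v (L v) K \<psi>)"
proof -
  obtain f g where fg: "\<And>x. x \<in> PiE V L \<Longrightarrow> \<psi> x = (\<Sum>j\<in>J. f j (x s) * g j (x(s := {})))"
    using assms(1) by (auto simp: schmidt_factors_def)
  have kv: "kraus_vector v (L v) K \<psi> x =
      (\<Sum>a\<in>L v. K (x v) a * (\<Sum>j\<in>J. f j ((x(v := a)) s) * g j ((x(v := a))(s := {}))))"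
    if "x \<in> PiE V (L(v := A))" for x
    unfolding kraus_vector_def using PiE_update[OF that _ assms(2)] fg by (intro sum.cong) auto
  show ?thesis
  proof (cases "v = s")
    case True
    have "kraus_vector v (L v) K \<psi> x =
        (\<Sum>j\<in>J. (\<Sum>a\<in>L v. K (x s) a * f j a) * g j (x(s := {})))"
      if "x \<in> PiE V (L(v := A))" for x
      unfolding kv[OF that] using True
      by (simp add: sum_distrib_left sum_distrib_right sum.swap[of _ J] mult_ac)
    then show ?thesis unfolding schmidt_factors_def
      by (intro exI[of _ "\<lambda>j c. \<Sum>a\<in>L v. K c a * f j a"] exI[of _ g]) blast
  next
    case False
    have "kraus_vector v (L v) K \<psi> x =
        (\<Sum>j\<in>J. f j (x s) * (\<Sum>a\<in>L v. K ((x(s := {})) v) a * g j ((x(s := {}))(v := a))))"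
      if "x \<in> PiE V (L(v := A))" for x
      unfolding kv[OF that] using False
      by (simp add: sum_distrib_left sum_distrib_right sum.swap[of _ J] mult_ac fun_upd_twist)
    then show ?thesis unfolding schmidt_factors_def
      by (intro exI[of _ f] exI[of _ "\<lambda>j y. \<Sum>a\<in>L v. K (y v) a * g j (y(v := a))"]) blast
  qed
qed

lemma sum_list_concat_map:
  "(\<Sum>z\<leftarrow>concat (map F xs). h z) = (\<Sum>x\<leftarrow>xs. \<Sum>z\<leftarrow>F x. h z)"
  by (induction xs) simp_all

text \<open>Conjugation by \<open>K\<close> sends the projector on a vector to the projector on its
  image, so the new ensemble consists of all images of old vectors under all Kraus
  operators.\<close>

lemma pure_mixture_apply_kraus:
  assumes "pure_mixture V (L, \<rho>) \<Psi>" "v \<in> V"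
  shows "pure_mixture V (L(v := A), apply_kraus v (L v) Ks \<rho>)
    (concat (map (\<lambda>K. map (kraus_vector v (L v) K) \<Psi>) Ks))"
  unfolding pure_mixture_def fst_conv snd_conv
proof (intro ballI)
  fix x y assume x: "x \<in> PiE V (L(v := A))" and y: "y \<in> PiE V (L(v := A))"
  have "apply_kraus v (L v) Ks \<rho> x y =
      (\<Sum>K\<leftarrow>Ks. \<Sum>a\<in>L v. \<Sum>b\<in>L v. K (x v) a * (\<Sum>\<psi>\<leftarrow>\<Psi>. \<psi> (x(v := a)) * cnj (\<psi> (y(v := b)))) * cnj (K (y v) b))"
    unfolding apply_kraus_def
  proof (intro arg_cong[where f = sum_list] map_cong refl sum.cong)
    fix K a b assume "a \<in> L v" "b \<in> L v"
    then show "K (x v) a * \<rho> (x(v := a)) (y(v := b)) * cnj (K (y v) b) =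
      K (x v) a * (\<Sum>\<psi>\<leftarrow>\<Psi>. \<psi> (x(v := a)) * cnj (\<psi> (y(v := b)))) * cnj (K (y v) b)"
      using assms(1) PiE_update[OF x _ assms(2)] PiE_update[OF y _ assms(2)]
      by (simp add: pure_mixture_def)
  qed
  also have "\<dots> = (\<Sum>K\<leftarrow>Ks. \<Sum>\<psi>\<leftarrow>\<Psi>. \<Sum>a\<in>L v. \<Sum>b\<in>L v.
      K (x v) a * (\<psi> (x(v := a)) * cnj (\<psi> (y(v := b)))) * cnj (K (y v) b))"
    by (simp only: sum_list_sum_swap sum_list_const_mult sum_list_mult_const)
  also have "\<dots> = (\<Sum>K\<leftarrow>Ks. \<Sum>\<psi>\<leftarrow>\<Psi>. kraus_vector v (L v) K \<psi> x * cnj (kraus_vector v (L v) K \<psi> y))"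
    by (simp add: kraus_vector_def sum_product mult_ac)
  finally show "apply_kraus v (L v) Ks \<rho> x y =
      (\<Sum>\<psi>\<leftarrow>concat (map (\<lambda>K. map (kraus_vector v (L v) K) \<Psi>) Ks). \<psi> x * cnj (\<psi> y))"
    by (simp add: sum_list_concat_map o_def)
qed

lemma pure_mixture_diag:
  assumes "pure_mixture V (L, \<rho>) \<Psi>" "x \<in> PiE V L"
  shows "\<rho> x x = of_real (\<Sum>\<psi>\<leftarrow>\<Psi>. (cmod (\<psi> x))\<^sup>2)"
proof -
  have "(\<Sum>\<psi>\<leftarrow>\<Psi>. \<psi> x * cnj (\<psi> x)) = of_real (\<Sum>\<psi>\<leftarrow>\<Psi>. (cmod (\<psi> x))\<^sup>2)"
    by (induction \<Psi>) (simp_all add: complex_norm_square[symmetric])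
  then show ?thesis using assms by (simp add: pure_mixture_def)
qed

lemma branch_prob_pure_mixture:
  assumes "pure_mixture V (L, \<rho>) \<Psi>"
  shows "branch_prob V (L, \<rho>) = (\<Sum>x\<in>PiE V L. \<Sum>\<psi>\<leftarrow>\<Psi>. (cmod (\<psi> x))\<^sup>2)"
  by (simp add: branch_prob_def pure_mixture_diag[OF assms] cong: sum.cong)

lemma branch_prob_nonneg:
  assumes "schmidt_bounded V s J b"
  shows "0 \<le> branch_prob V b"
proof -
  obtain \<Psi> where "pure_mixture V (fst b, snd b) \<Psi>"
    using assms by (auto simp: schmidt_bounded_def)
  from branch_prob_pure_mixture[OF this] show ?thesis
    by (auto intro!: sum_nonneg sum_list_nonneg)
qed

text \<open>The invariant of the protocol. Finite label sets are part of it because trace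
  preservation sums over them and instruments may replace them. Forgetting concatenates two
  ensembles without altering a vector, so loss of information does not affect the bound.\<close>

lemma schmidt_bounded_locc:
  assumes "locc V S M" "finite V" "\<forall>v\<in>V. finite (fst S v)" "schmidt_bounded V s J S"
  shows "(\<forall>b\<in>#M. (\<forall>v\<in>V. finite (fst b v)) \<and> schmidt_bounded V s J b)
    \<and> (\<Sum>b\<in>#M. branch_prob V b) = branch_prob V S"
  using assms(1)
proof induction
  case start
  then show ?case using assms by simp
next
  case (local_step L \<rho> M v I)
  let ?F = "\<lambda>(A, Ks). (L(v := A), apply_kraus v (L v) Ks \<rho>)"
  from local_step.IH have fin: "\<And>v. v \<in> V \<Longrightarrow> finite (L v)" and sb: "schmidt_bounded V s J (L, \<rho>)"
    by auto
  obtain \<Psi> where \<Psi>: "pure_mixture V (L, \<rho>) \<Psi>" "\<And>\<psi>. \<psi> \<in> set \<Psi> \<Longrightarrow> schmidt_factors V s J L \<psi>"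
    using sb by (auto simp: schmidt_bounded_def)
  have new: "(\<forall>w\<in>V. finite (fst (?F i) w)) \<and> schmidt_bounded V s J (?F i)" if "i \<in> set I" for i
  proof -
    obtain A Ks where i: "i = (A, Ks)" by force
    have "finite A" using that local_step.hyps i by (auto simp: instrument_def)
    moreover have "schmidt_bounded V s J (L(v := A), apply_kraus v (L v) Ks \<rho>)"
      unfolding schmidt_bounded_def
      using pure_mixture_apply_kraus[OF \<Psi>(1) \<open>v \<in> V\<close>, of A Ks]
        schmidt_factors_kraus_vector[OF \<Psi>(2) \<open>v \<in> V\<close>, of _ A]
      by (intro exI[of _ "concat (map (\<lambda>K. map (kraus_vector v (L v) K) \<Psi>) Ks)"]) auto
    ultimately show ?thesis using fin i by auto
  qed
  have "(\<Sum>b\<in>#mset (map ?F I). branch_prob V b) = (\<Sum>i\<leftarrow>I. branch_prob V (?F i))"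
    by (simp only: mset_map[symmetric] sum_mset_sum_list map_map o_def)
  also have "\<dots> = branch_prob V (L, \<rho>)"
    using trace_instrument[where L = L and v = v, OF assms(2) \<open>v \<in> V\<close> fin[OF \<open>v \<in> V\<close>] \<open>instrument (L v) I\<close>]
    by (simp add: case_prod_unfold)
  finally have "(\<Sum>b\<in>#M + mset (map ?F I). branch_prob V b) = branch_prob V S"
    using local_step.IH by (simp add: add.commute del: mset_map)
  then show ?case using local_step.IH new by auto
next
  case (forget L \<rho>\<^sub>1 \<rho>\<^sub>2 M)
  then have "schmidt_bounded V s J (L, \<rho>\<^sub>1)" "schmidt_bounded V s J (L, \<rho>\<^sub>2)"
    by auto
  then obtain \<Psi>\<^sub>1 \<Psi>\<^sub>2 where
    "pure_mixture V (L, \<rho>\<^sub>1) \<Psi>\<^sub>1" "\<forall>\<psi>\<in>set \<Psi>\<^sub>1. schmidt_factors V s J L \<psi>"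
    "pure_mixture V (L, \<rho>\<^sub>2) \<Psi>\<^sub>2" "\<forall>\<psi>\<in>set \<Psi>\<^sub>2. schmidt_factors V s J L \<psi>"
    by (auto simp: schmidt_bounded_def)
  then have "schmidt_bounded V s J (L, \<lambda>x y. \<rho>\<^sub>1 x y + \<rho>\<^sub>2 x y)"
    unfolding schmidt_bounded_def
    by (intro exI[of _ "\<Psi>\<^sub>1 @ \<Psi>\<^sub>2"]) (auto simp: pure_mixture_def)
  then show ?case using forget.IH
    by (auto simp: branch_prob_def sum.distrib)
qed


subsection \<open>Ideal pairs and Schmidt number\<close>

text \<open>By Gaussian elimination on the columns indexed by \<open>J\<close>.\<close>

lemma card_le_of_identity_factors:
  fixes f g :: "'j \<Rightarrow> 'x \<Rightarrow> 'a :: field"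
  assumes "finite J" "finite X"
    and "\<And>S T. S \<in> X \<Longrightarrow> T \<in> X \<Longrightarrow> (\<Sum>j\<in>J. f j S * g j T) = of_bool (S = T)"
  shows "card X \<le> card J"
  using assms
proof (induction J arbitrary: X f rule: finite_induct)
  case empty
  then have "X = {}" by fastforce
  then show ?case by simp
next
  case (insert k J)
  show ?case
  proof (cases "\<forall>S\<in>X. f k S = 0")
    case True
    then have "card X \<le> card J" using insert.hyps insert.prems by (intro insert.IH[of X f]) auto
    then show ?thesis using insert by simp
  next
    case False
    then obtain S\<^sub>0 where S\<^sub>0: "S\<^sub>0 \<in> X" "f k S\<^sub>0 \<noteq> 0" by auto
    define f' where "f' j S = f j S - f k S / f k S\<^sub>0 * f j S\<^sub>0" for j S
    have "card (X - {S\<^sub>0}) \<le> card J"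
    proof (rule insert.IH)
      fix S T assume ST: "S \<in> X - {S\<^sub>0}" "T \<in> X - {S\<^sub>0}"
      have "f' k S = 0" using S\<^sub>0 by (simp add: f'_def)
      then have "(\<Sum>j\<in>J. f' j S * g j T) = (\<Sum>j\<in>insert k J. f' j S * g j T)"
        using insert.hyps by simp
      also have "\<dots> = (\<Sum>j\<in>insert k J. f j S * g j T)
          - f k S / f k S\<^sub>0 * (\<Sum>j\<in>insert k J. f j S\<^sub>0 * g j T)"
        unfolding f'_def sum_distrib_left sum_subtractf[symmetric]
        by (intro sum.cong) (simp_all add: algebra_simps)
      \<comment> \<open>The multiple of the pivot row contributes nothing because \<open>T\<close>
        differs from \<open>S\<^sub>0\<close>.\<close>
      also have "\<dots> = of_bool (S = T)"
        using insert.prems(2)[of S T] insert.prems(2)[of S\<^sub>0 T] S\<^sub>0 ST by auto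
      finally show "(\<Sum>j\<in>J. f' j S * g j T) = of_bool (S = T)" .
    qed (use insert in auto)
    then show ?thesis using insert S\<^sub>0 by simp
  qed
qed


section \<open>Fidelity one as a condition on amplitudes\<close>

lemma sum_register_split:
  assumes "finite A" "\<And>x. x \<in> A \<Longrightarrow> x(v := insert r (x v)) \<in> A" "\<And>x. x \<in> A \<Longrightarrow> x(v := x v - {r}) \<in> A"
  shows "(\<Sum>x\<in>A. f x) = (\<Sum>x\<in>{x\<in>A. r \<notin> x v}. f x + f (x(v := insert r (x v))))"
proof -
  have "(\<Sum>x\<in>A. f x) = (\<Sum>x\<in>{x\<in>A. r \<notin> x v}. f x) + (\<Sum>x\<in>{x\<in>A. r \<in> x v}. f x)"
    using assms(1) by (subst sum.union_disjoint[symmetric]) (auto intro!: sum.cong)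
  also have "(\<Sum>x\<in>{x\<in>A. r \<in> x v}. f x) = (\<Sum>x\<in>{x\<in>A. r \<notin> x v}. f (x(v := insert r (x v))))"
    by (rule sum.reindex_bij_witness[of _ "\<lambda>x. x(v := insert r (x v))" "\<lambda>x. x(v := x v - {r})"])
      (auto simp: assms insert_absorb)
  finally show ?thesis by (simp add: sum.distrib)
qed

lemma is_qubit_insert: "is_qubit A r \<Longrightarrow> a \<in> A \<Longrightarrow> insert r a \<in> A"
  and is_qubit_remove: "is_qubit A r \<Longrightarrow> a \<in> A \<Longrightarrow> a - {r} \<in> A"
  by (auto simp: is_qubit_def)

lemma PiE_register:
  assumes "x \<in> PiE V L" "w \<in> V" "is_qubit (L w) r"
  shows "x(w := insert r (x w)) \<in> PiE V L" and "x(w := x w - {r}) \<in> PiE V L"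
  using PiE_update_same[OF assms(1) is_qubit_insert[OF assms(3) PiE_mem[OF assms(1,2)]] assms(2)]
    PiE_update_same[OF assms(1) is_qubit_remove[OF assms(3) PiE_mem[OF assms(1,2)]] assms(2)] .

text \<open>Joint labels fall into blocks of four, one for each value of the two bits called
  \<open>r\<close>; the label with both bits clear represents its block.\<close>

lemma sum_two_registers_split:
  assumes "finite V" "\<And>v. v \<in> V \<Longrightarrow> finite (L v)" "u \<in> V" "v \<in> V" "u \<noteq> v"
    and "is_qubit (L u) r" "is_qubit (L v) r"
  shows "(\<Sum>x\<in>PiE V L. f x) = (\<Sum>x\<in>{x\<in>PiE V L. \<forall>w\<in>{u, v}. r \<notin> x w}.
    f x + f (x(v := insert r (x v))) + (f (x(u := insert r (x u))) + f (x(u := insert r (x u), v := insert r (x v)))))"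
proof -
  have fin: "finite (PiE V L)" using assms by (intro finite_PiE) auto
  have closed: "x(w := insert r (x w)) \<in> PiE V L" "x(w := x w - {r}) \<in> PiE V L"
    if "x \<in> PiE V L" "w \<in> {u, v}" for x w
    using that assms PiE_register[of x V L w r] by auto
  have "(\<Sum>x\<in>PiE V L. f x) = (\<Sum>x\<in>{x\<in>PiE V L. r \<notin> x u}. f x + f (x(u := insert r (x u))))"
    using fin closed by (intro sum_register_split) auto
  also have "\<dots> = (\<Sum>x\<in>{x\<in>{x\<in>PiE V L. r \<notin> x u}. r \<notin> x v}. f x + f (x(u := insert r (x u)))
      + (f (x(v := insert r (x v))) + f ((x(v := insert r (x v)))(u := insert r ((x(v := insert r (x v))) u)))))"
    using fin closed assms(5) by (intro sum_register_split) auto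
  also have "\<dots> = (\<Sum>x\<in>{x\<in>PiE V L. \<forall>w\<in>{u, v}. r \<notin> x w}.
    f x + f (x(v := insert r (x v))) + (f (x(u := insert r (x u))) + f (x(u := insert r (x u), v := insert r (x v)))))"
    using assms(5) by (intro sum.cong) (auto simp: fun_upd_twist add_ac)
  finally show ?thesis .
qed

lemma set_register_pair:
  assumes "r \<notin> x u" "r \<notin> x v" "u \<noteq> v"
  shows "set_register {u, v} r False x = x"
    and "set_register {u, v} r True x = x(u := insert r (x u), v := insert r (x v))"
  using assms by (auto simp: set_register_def fun_eq_iff)

lemma norm_add_parallelogram: "(cmod (a + b))\<^sup>2 + (cmod (a - b))\<^sup>2 = 2 * (cmod a)\<^sup>2 + 2 * (cmod b)\<^sup>2"
  unfolding cmod_power2 by (simp add: power2_eq_square algebra_simps)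

lemma sum_list_divide: "(\<Sum>x\<leftarrow>xs. f x / c) = (\<Sum>x\<leftarrow>xs. f x) / (c :: real)"
  by (induction xs) (simp_all add: add_divide_distrib)

text \<open>The squared length of the component orthogonal to the Bell vector in the block of
  \<open>x\<close>: the weights on 01 and 10, and the weight on the Bell vector with opposite
  sign.\<close>

definition bell_deficit ::
    "'v \<Rightarrow> 'v \<Rightarrow> 'r \<Rightarrow> (('v \<Rightarrow> 'r set) \<Rightarrow> complex) \<Rightarrow> ('v \<Rightarrow> 'r set) \<Rightarrow> real" where
  "bell_deficit u v r \<psi> x = (cmod (\<psi> (x(v := insert r (x v)))))\<^sup>2 + (cmod (\<psi> (x(u := insert r (x u)))))\<^sup>2
     + (cmod (\<psi> x - \<psi> (x(u := insert r (x u), v := insert r (x v)))))\<^sup>2 / 2"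

lemma bell_deficit_nonneg: "0 \<le> bell_deficit u v r \<psi> x"
  by (simp add: bell_deficit_def)

text \<open>The numerator of the fidelity is the trace minus the total deficit. All deficits are
  nonnegative, so fidelity one makes each of them vanish, for every vector of any ensemble of the
  branch. A branch of probability zero is excluded explicitly: division by zero gives it fidelity
  0.\<close>

lemma bell_fidelity_eq_1_iff:
  assumes "finite V" "\<And>v. v \<in> V \<Longrightarrow> finite (L v)" "u \<in> V" "v \<in> V" "u \<noteq> v"
    and "is_qubit (L u) r" "is_qubit (L v) r" and \<Psi>: "pure_mixture V (L, \<rho>) \<Psi>"
  shows "bell_fidelity V {u, v} r (L, \<rho>) = 1 \<longleftrightarrow> branch_prob V (L, \<rho>) \<noteq> 0 \<and>
    (\<forall>\<psi>\<in>set \<Psi>. \<forall>x\<in>PiE V L. r \<notin> x u \<longrightarrow> r \<notin> x v \<longrightarrow> bell_deficit u v r \<psi> x = 0)"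
proof -
  define Z where "Z = {x\<in>PiE V L. \<forall>w\<in>{u, v}. r \<notin> x w}"
  let ?uv = "\<lambda>x. x(u := insert r (x u), v := insert r (x v))"
  have finZ: "finite Z"
    using finite_PiE[of V L] assms by (simp add: Z_def)
  define D where "D = (\<Sum>x\<in>Z. \<Sum>\<psi>\<leftarrow>\<Psi>. bell_deficit u v r \<psi> x)"
  have uv: "?uv x \<in> PiE V L" if "x \<in> Z" for x
    using that assms PiE_register(1)[OF PiE_register(1)[of x V L u r], of v r] by (simp add: Z_def)
  have num: "Re (1 / 2 * (\<Sum>b\<in>UNIV. \<Sum>c\<in>UNIV. \<rho> (set_register {u, v} r b x) (set_register {u, v} r c x)))
    = (\<Sum>\<psi>\<leftarrow>\<Psi>. (cmod (\<psi> x + \<psi> (?uv x)))\<^sup>2 / 2)" if "x \<in> Z" for x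
  proof -
    have x: "r \<notin> x u" "r \<notin> x v" "x \<in> PiE V L" using that by (auto simp: Z_def)
    have "(\<Sum>b\<in>UNIV. \<Sum>c\<in>UNIV. \<rho> (set_register {u, v} r b x) (set_register {u, v} r c x))
        = \<rho> x x + \<rho> x (?uv x) + (\<rho> (?uv x) x + \<rho> (?uv x) (?uv x))"
      by (simp add: UNIV_bool set_register_pair[OF x(1,2) assms(5)] add_ac)
    also have "\<dots> = (\<Sum>\<psi>\<leftarrow>\<Psi>. \<psi> x * cnj (\<psi> x)) + (\<Sum>\<psi>\<leftarrow>\<Psi>. \<psi> x * cnj (\<psi> (?uv x)))
        + ((\<Sum>\<psi>\<leftarrow>\<Psi>. \<psi> (?uv x) * cnj (\<psi> x)) + (\<Sum>\<psi>\<leftarrow>\<Psi>. \<psi> (?uv x) * cnj (\<psi> (?uv x))))"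
      using \<Psi> x(3) uv[OF that] by (simp add: pure_mixture_def)
    also have "\<dots> = (\<Sum>\<psi>\<leftarrow>\<Psi>. (\<psi> x + \<psi> (?uv x)) * cnj (\<psi> x + \<psi> (?uv x)))"
      unfolding sum_list_addf[symmetric]
      by (intro arg_cong[where f = sum_list] map_cong refl) (simp only: complex_cnj_add distrib_left distrib_right add_ac)
    also have "\<dots> = of_real (\<Sum>\<psi>\<leftarrow>\<Psi>. (cmod (\<psi> x + \<psi> (?uv x)))\<^sup>2)"
      by (induction \<Psi>) (simp_all add: complex_norm_square[symmetric] del: complex_cnj_add)
    finally show ?thesis
      by (simp add: sum_list_divide)
  qed
  have trace: "branch_prob V (L, \<rho>) = (\<Sum>x\<in>Z. \<Sum>\<psi>\<leftarrow>\<Psi>. (cmod (\<psi> x))\<^sup>2 + (cmod (\<psi> (x(v := insert r (x v)))))\<^sup>2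
      + ((cmod (\<psi> (x(u := insert r (x u)))))\<^sup>2 + (cmod (\<psi> (?uv x)))\<^sup>2))"
  proof -
    have "branch_prob V (L, \<rho>) = (\<Sum>x\<in>PiE V L. \<Sum>\<psi>\<leftarrow>\<Psi>. (cmod (\<psi> x))\<^sup>2)"
      by (rule branch_prob_pure_mixture[OF \<Psi>])
    also note sum_two_registers_split[OF assms(1-7)]
    finally show ?thesis by (simp only: Z_def sum_list_addf)
  qed
  have half: "Re (1 / 2 * (\<Sum>x\<in>Z. G x)) = (\<Sum>x\<in>Z. Re (1 / 2 * G x))" for G :: "_ \<Rightarrow> complex"
    by (simp add: sum_divide_distrib)
  have "Re (1 / 2 * (\<Sum>x\<in>Z. \<Sum>b\<in>UNIV. \<Sum>c\<in>UNIV.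
      \<rho> (set_register {u, v} r b x) (set_register {u, v} r c x))) =
      (\<Sum>x\<in>Z. \<Sum>\<psi>\<leftarrow>\<Psi>. (cmod (\<psi> x + \<psi> (?uv x)))\<^sup>2 / 2)"
    by (simp only: half num cong: sum.cong)
  also have "\<dots> = branch_prob V (L, \<rho>) - D"
  proof -
    \<comment> \<open>Parallelogram law: the weights on the Bell vectors of either sign add up to
      those on 00 and 11.\<close>
    have "(cmod (\<psi> x + \<psi> (?uv x)))\<^sup>2 / 2 + bell_deficit u v r \<psi> x = (cmod (\<psi> x))\<^sup>2 + (cmod (\<psi> (x(v := insert r (x v)))))\<^sup>2
      + ((cmod (\<psi> (x(u := insert r (x u)))))\<^sup>2 + (cmod (\<psi> (?uv x)))\<^sup>2)" for \<psi> x
      using norm_add_parallelogram[of "\<psi> x" "\<psi> (?uv x)"] by (simp add: bell_deficit_def)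
    then have "branch_prob V (L, \<rho>) =
        (\<Sum>x\<in>Z. \<Sum>\<psi>\<leftarrow>\<Psi>. (cmod (\<psi> x + \<psi> (?uv x)))\<^sup>2 / 2 + bell_deficit u v r \<psi> x)"
      unfolding trace by (intro sum.cong refl arg_cong[where f = sum_list] map_cong) simp
    then show ?thesis
      by (simp only: sum_list_addf sum.distrib D_def)
  qed
  finally have fid: "bell_fidelity V {u, v} r (L, \<rho>) = (branch_prob V (L, \<rho>) - D) / branch_prob V (L, \<rho>)"
    by (simp only: bell_fidelity_def prod.case Z_def)
  have "D = 0 \<longleftrightarrow> (\<forall>x\<in>Z. (\<Sum>\<psi>\<leftarrow>\<Psi>. bell_deficit u v r \<psi> x) = 0)"
    unfolding D_def using finZ by (intro sum_nonneg_eq_0_iff sum_list_nonneg) (auto simp: bell_deficit_nonneg)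
  also have "\<dots> \<longleftrightarrow> (\<forall>x\<in>Z. \<forall>\<psi>\<in>set \<Psi>. bell_deficit u v r \<psi> x = 0)"
    by (subst sum_list_nonneg_eq_0_iff) (auto simp: bell_deficit_nonneg)
  finally have D: "D = 0 \<longleftrightarrow> (\<forall>x\<in>Z. \<forall>\<psi>\<in>set \<Psi>. bell_deficit u v r \<psi> x = 0)" .
  have "bell_fidelity V {u, v} r (L, \<rho>) = 1 \<longleftrightarrow> branch_prob V (L, \<rho>) \<noteq> 0 \<and> D = 0"
    unfolding fid by (auto simp: field_simps)
  then show ?thesis unfolding D Z_def by auto
qed


text \<open>The coordinate form of a Bell vector on the two qubits tensored with an arbitrary vector
  of everything else.\<close>

definition bell_correlated ::
    "'v set \<Rightarrow> ('v, 'r) spaces \<Rightarrow> 'v \<Rightarrow> 'v \<Rightarrow> 'r \<Rightarrow> (('v \<Rightarrow> 'r set) \<Rightarrow> complex) \<Rightarrow> bool" where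
  "bell_correlated V L u v r \<psi> \<longleftrightarrow>
     (\<forall>x\<in>PiE V L. (r \<in> x u) \<noteq> (r \<in> x v) \<longrightarrow> \<psi> x = 0) \<and>
     (\<forall>x\<in>PiE V L. r \<notin> x u \<longrightarrow> r \<notin> x v \<longrightarrow> \<psi> (x(u := insert r (x u), v := insert r (x v))) = \<psi> x)"

lemma bell_correlated_of_fidelity:
  assumes "finite V" "\<And>v. v \<in> V \<Longrightarrow> finite (L v)" "u \<in> V" "v \<in> V" "u \<noteq> v"
    and "is_qubit (L u) r" "is_qubit (L v) r" and "pure_mixture V (L, \<rho>) \<Psi>"
    and "bell_fidelity V {u, v} r (L, \<rho>) = 1" "\<psi> \<in> set \<Psi>"
  shows "bell_correlated V L u v r \<psi>"
proof -
  have "bell_deficit u v r \<psi> x = 0" if "x \<in> PiE V L" "r \<notin> x u" "r \<notin> x v" for x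
    using that assms(9,10) bell_fidelity_eq_1_iff[OF assms(1-8)] by blast
  then have zero: "\<psi> (x(v := insert r (x v))) = 0 \<and> \<psi> (x(u := insert r (x u))) = 0
      \<and> \<psi> (x(u := insert r (x u), v := insert r (x v))) = \<psi> x"
    if "x \<in> PiE V L" "r \<notin> x u" "r \<notin> x v" for x
    using that by (fastforce simp: bell_deficit_def add_nonneg_eq_0_iff)
  \<comment> \<open>The deficit is known only at block representatives. Clearing the one bit that is
    set leads to the representative, and setting it again returns to \<open>x\<close>.\<close>
  have "\<psi> x = 0" if x: "x \<in> PiE V L" "(r \<in> x u) \<noteq> (r \<in> x v)" for x
  proof (cases "r \<in> x u")
    case True
    have "x(u := x u - {r}) \<in> PiE V L" using x assms by (intro PiE_register)
    then have "\<psi> ((x(u := x u - {r}))(u := insert r ((x(u := x u - {r})) u))) = 0"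
      using zero True x(2) assms(5) by (intro zero[THEN conjunct2, THEN conjunct1]) auto
    then show ?thesis using True by (simp add: insert_absorb)
  next
    case False
    have "x(v := x v - {r}) \<in> PiE V L" using x assms by (intro PiE_register)
    then have "\<psi> ((x(v := x v - {r}))(v := insert r ((x(v := x v - {r})) v))) = 0"
      using zero False x(2) assms(5) by (intro zero[THEN conjunct1]) auto
    then show ?thesis using False x(2) by (simp add: insert_absorb)
  qed
  then show ?thesis using zero by (auto simp: bell_correlated_def)
qed

lemma qubits_union:
  assumes "finite S" "\<And>r. r \<in> S \<Longrightarrow> is_qubit A r" "a \<in> A"
  shows "a \<union> S \<in> A"
  using assms by (induction S rule: finite_induct) (auto intro: is_qubit_insert)

lemma qubits_diff:
  assumes "finite S" "\<And>r. r \<in> S \<Longrightarrow> is_qubit A r" "a \<in> A"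
  shows "a - S \<in> A"
  using assms
proof (induction S rule: finite_induct)
  case (insert r S)
  then have "a - S - {r} \<in> A" by (intro is_qubit_remove) auto
  then show ?case by (subst Diff_insert)
qed simp

lemma bell_correlated_toggle:
  assumes "finite S" "u \<in> V" "v \<in> V" "u \<noteq> v"
    and "\<And>r. r \<in> S \<Longrightarrow> is_qubit (L u) r" "\<And>r. r \<in> S \<Longrightarrow> is_qubit (L v) r"
    and "\<And>r. r \<in> S \<Longrightarrow> bell_correlated V L u v r \<psi>"
    and "x \<in> PiE V L" "x u \<inter> S = {}" "x v \<inter> S = {}"
  shows "\<psi> (x(u := x u \<union> S, v := x v \<union> S)) = \<psi> x"
  using assms
proof (induction S rule: finite_induct)
  case (insert r S)
  let ?y = "x(u := x u \<union> S, v := x v \<union> S)"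
  have "?y \<in> PiE V L"
    using insert.prems insert.hyps(1) by (intro PiE_update_same qubits_union) auto
  moreover have "r \<notin> ?y u" "r \<notin> ?y v" using insert by auto
  moreover have "bell_correlated V L u v r \<psi>" using insert.prems by simp
  ultimately have "\<psi> (?y(u := insert r (?y u), v := insert r (?y v))) = \<psi> ?y"
    unfolding bell_correlated_def by blast
  moreover have "?y(u := insert r (?y u), v := insert r (?y v)) =
      x(u := x u \<union> insert r S, v := x v \<union> insert r S)"
    using \<open>u \<noteq> v\<close> by (auto simp: fun_eq_iff)
  moreover have "\<psi> ?y = \<psi> x" using insert.prems by (intro insert.IH) auto
  ultimately show ?case by (simp only:)
qed simp

text \<open>Fix all labels outside the registers in \<open>R\<close>. The amplitude as a matrix,
  with rows given by the bits at \<open>u\<close> and columns by the bits at \<open>v\<close>, is a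
  nonzero multiple of the identity on subsets of \<open>R\<close>; a factorization through
  \<open>J\<close> bounds its rank by \<open>card J\<close>.\<close>

lemma card_bell_correlated_le:
  assumes "finite R" "finite J" "u \<in> V" "v \<in> V" "u \<noteq> v"
    and q: "\<And>r. r \<in> R \<Longrightarrow> is_qubit (L u) r" "\<And>r. r \<in> R \<Longrightarrow> is_qubit (L v) r"
    and corr: "\<And>r. r \<in> R \<Longrightarrow> bell_correlated V L u v r \<psi>"
    and "schmidt_factors V u J L \<psi>" "z \<in> PiE V L" "\<psi> z \<noteq> 0"
  shows "2 ^ card R \<le> card J"
proof -
  define x where "x = z(u := z u - R, v := z v - R)"
  have x: "x \<in> PiE V L"
    unfolding x_def using assms
    by (intro PiE_update_same qubits_diff) (auto intro: PiE_mem)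
  have disj: "x u \<inter> R = {}" "x v \<inter> R = {}" by (auto simp: x_def)
  have sub: "finite S \<and> (\<forall>r\<in>S. is_qubit (L u) r) \<and> (\<forall>r\<in>S. is_qubit (L v) r)" if "S \<subseteq> R" for S
    using that assms finite_subset by blast
  have toggle: "\<psi> (x(u := x u \<union> S, v := x v \<union> S)) = \<psi> x" if "S \<subseteq> R" for S
    using that sub[OF that] assms x disj by (intro bell_correlated_toggle[where L = L and V = V]) auto
  \<comment> \<open>Nonzero amplitude forces equal bits at both ends, so \<open>z\<close> arises
    from the cleared label \<open>x\<close> by setting the same registers on both sides, and
    \<open>\<psi> x\<close> inherits the nonzero amplitude.\<close>
  have "z u \<inter> R = z v \<inter> R"
    using corr \<open>z \<in> PiE V L\<close> \<open>\<psi> z \<noteq> 0\<close> unfolding bell_correlated_def by blast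
  then have "z = x(u := x u \<union> (z u \<inter> R), v := x v \<union> (z u \<inter> R))"
    using \<open>u \<noteq> v\<close> by (auto simp: x_def fun_eq_iff)
  then have "\<psi> x \<noteq> 0" using toggle[of "z u \<inter> R"] \<open>\<psi> z \<noteq> 0\<close> by auto
  have delta: "\<psi> (x(u := x u \<union> S, v := x v \<union> T)) = \<psi> x * of_bool (S = T)" if ST: "S \<subseteq> R" "T \<subseteq> R" for S T
  proof (cases "S = T")
    case True
    then show ?thesis using toggle ST by simp
  next
    case False
    then obtain r where r: "r \<in> R" "(r \<in> S) \<noteq> (r \<in> T)" using ST by blast
    let ?y = "x(u := x u \<union> S, v := x v \<union> T)"
    have "?y \<in> PiE V L"
      using sub[OF ST(1)] sub[OF ST(2)] assms x
      by (intro PiE_update_same qubits_union) (auto intro: PiE_mem)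
    moreover have "(r \<in> ?y u) \<noteq> (r \<in> ?y v)" using r disj \<open>u \<noteq> v\<close> by auto
    ultimately have "\<psi> ?y = 0" using corr[OF r(1)] unfolding bell_correlated_def by blast
    then show ?thesis using False by simp
  qed
  obtain f g where fg: "\<And>x. x \<in> PiE V L \<Longrightarrow> \<psi> x = (\<Sum>j\<in>J. f j (x u) * g j (x(u := {})))"
    using assms by (auto simp: schmidt_factors_def)
  have "card (Pow R) \<le> card J"
  proof (rule card_le_of_identity_factors)
    fix S T assume ST: "S \<in> Pow R" "T \<in> Pow R"
    let ?y = "x(u := x u \<union> S, v := x v \<union> T)"
    have "?y \<in> PiE V L"
      using sub[of S] sub[of T] ST assms x
      by (intro PiE_update_same qubits_union) (auto intro: PiE_mem)
    then have "\<psi> ?y = (\<Sum>j\<in>J. f j (?y u) * g j (?y(u := {})))" by (rule fg)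
    also have "\<dots> = (\<Sum>j\<in>J. f j (x u \<union> S) * g j (x(u := {}, v := x v \<union> T)))"
      using \<open>u \<noteq> v\<close> by (simp add: fun_upd_twist)
    finally have "(\<Sum>j\<in>J. f j (x u \<union> S) * g j (x(u := {}, v := x v \<union> T))) = \<psi> x * of_bool (S = T)"
      using delta ST by simp
    then show "(\<Sum>j\<in>J. (f j (x u \<union> S) / \<psi> x) * g j (x(u := {}, v := x v \<union> T))) = of_bool (S = T)"
      using \<open>\<psi> x \<noteq> 0\<close> by (simp add: sum_divide_distrib[symmetric])
  qed (use assms in auto)
  then show ?thesis using \<open>finite R\<close> by (simp add: card_Pow)
qed

lemma ideal_pairs_le:
  assumes "finite V" "\<And>v. v \<in> V \<Longrightarrow> finite (fst b v)" "u \<in> V" "v \<in> V" "u \<noteq> v"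
    and "schmidt_bounded V u J b" "finite J" "branch_prob V b \<noteq> 0"
  shows "2 ^ ideal_pairs V {u, v} b \<le> card J"
proof -
  obtain L \<rho> where b: "b = (L, \<rho>)" by force
  obtain \<Psi> where \<Psi>: "pure_mixture V (L, \<rho>) \<Psi>" "\<forall>\<psi>\<in>set \<Psi>. schmidt_factors V u J L \<psi>"
    using assms(6) by (auto simp: schmidt_bounded_def b)
  \<comment> \<open>One nonzero vector suffices: fidelity one for several registers constrains this
    same vector for all of them, so the pairs are counted jointly.\<close>
  have "\<exists>\<psi>\<in>set \<Psi>. \<exists>x\<in>PiE V L. \<psi> x \<noteq> 0"
  proof (rule ccontr)
    assume "\<not> ?thesis"
    then have "branch_prob V (L, \<rho>) = (\<Sum>x\<in>PiE V L. \<Sum>\<psi>\<leftarrow>\<Psi>. 0)"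
      unfolding branch_prob_pure_mixture[OF \<Psi>(1)]
      by (intro sum.cong refl arg_cong[where f = sum_list] map_cong) auto
    then show False using assms(8) b by (simp add: sum_list_0)
  qed
  then obtain \<psi> z where \<psi>: "\<psi> \<in> set \<Psi>" "z \<in> PiE V L" "\<psi> z \<noteq> 0" by blast
  define R where "R = {r. (\<forall>w\<in>{u, v}. is_qubit (L w) r) \<and> bell_fidelity V {u, v} r (L, \<rho>) = 1}"
  have corr: "bell_correlated V L u v r \<psi>" if "r \<in> R" for r
    using that assms(1-5) \<psi>(1) by (intro bell_correlated_of_fidelity[OF _ _ _ _ _ _ _ \<Psi>(1)]) (auto simp: R_def b)
  have card: "ideal_pairs V {u, v} b = card R"
    by (simp add: ideal_pairs_def b R_def)
  show ?thesis
  proof (cases "finite R")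
    case True
    then show ?thesis
      unfolding card using corr \<psi> \<Psi>(2) assms
      by (intro card_bell_correlated_le[where V = V and L = L and \<psi> = \<psi>]) (auto simp: R_def)
  next
    \<comment> \<open>An infinite set has cardinality 0, which leaves \<open>1 \<le> card J\<close>;
      a nonzero vector is not an empty sum, so \<open>J\<close> is nonempty.\<close>
    case False
    moreover have "J \<noteq> {}" using \<psi> \<Psi>(2) by (fastforce simp: schmidt_factors_def)
    ultimately show ?thesis using assms(7) by (simp add: card Suc_le_eq card_gt_0_iff)
  qed
qed


subsection \<open>The retained states\<close>

text \<open>Arbitrary amplitudes per pair, because filtering changes \<open>\<alpha>\<close> at a
  single pair; retained and filtered states are then covered by one norm formula.\<close>

definition pair_amplitude ::
    "('v set \<Rightarrow> complex) \<Rightarrow> ('v set \<Rightarrow> complex) \<Rightarrow> 'v set \<Rightarrow> ('v \<Rightarrow> 'v set set) \<Rightarrow> complex" where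
  "pair_amplitude \<alpha> \<beta> V x = (\<Prod>p \<in> nsets V 2.
     if \<forall>v\<in>p. p \<notin> x v then \<alpha> p else if \<forall>v\<in>p. p \<in> x v then \<beta> p else 0)"

lemma retained_amplitude_eq:
  "retained_amplitude \<theta> V E = pair_amplitude (\<lambda>p. of_real (sqrt (retained_schmidt \<theta> E p)))
     (\<lambda>p. of_real (sqrt (1 - retained_schmidt \<theta> E p))) V"
  by (simp add: retained_amplitude_def pair_amplitude_def fun_eq_iff)

definition pair_labels :: "'v set \<Rightarrow> 'v \<Rightarrow> 'v set set set" where
  "pair_labels V v = Pow {p \<in> nsets V 2. v \<in> p}"

lemma finite_pair_labels: "finite V \<Longrightarrow> finite (pair_labels V v)"
  by (simp add: pair_labels_def finite_imp_finite_nsets)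

lemma pair_amplitude_nonzero:
  assumes "finite V" "pair_amplitude \<alpha> \<beta> V x \<noteq> 0" "p \<in> nsets V 2"
  shows "(\<forall>v\<in>p. p \<notin> x v) \<or> (\<forall>v\<in>p. p \<in> x v)"
proof (rule ccontr)
  assume "\<not> ?thesis"
  then have "pair_amplitude \<alpha> \<beta> V x = 0"
    unfolding pair_amplitude_def using assms
    by (intro prod_zero bexI[of _ p]) (auto simp: finite_imp_finite_nsets)
  then show False using assms by simp
qed

text \<open>Only labels with equal bits at both ends of every pair contribute, and these correspond
  to the sets \<open>Q\<close> of pairs in state 11. The sum over \<open>Q\<close> is the expansion
  of the product.\<close>

lemma norm_pair_amplitude_sum:
  assumes "finite V"
  shows "(\<Sum>x\<in>PiE V (pair_labels V). (cmod (pair_amplitude \<alpha> \<beta> V x))\<^sup>2) =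
    (\<Prod>p\<in>nsets V 2. (cmod (\<alpha> p))\<^sup>2 + (cmod (\<beta> p))\<^sup>2)"
proof -
  \<comment> \<open>The joint label in which exactly the pairs in \<open>Q\<close> carry 1.
    Restriction to \<open>V\<close> supplies the value \<open>undefined\<close> outside, as
    membership in \<open>PiE\<close> demands.\<close>
  define lab where "lab Q = (\<lambda>v\<in>V. {p \<in> Q. v \<in> p})" for Q :: "'a set set"
  have fin: "finite (nsets V 2)" using assms by (simp add: finite_imp_finite_nsets)
  have sub: "p \<subseteq> V \<and> p \<noteq> {}" if "p \<in> nsets V 2" for p
    using that by (auto simp: nsets_def)
  have lab_iff: "p \<in> lab Q v \<longleftrightarrow> p \<in> Q" if "p \<in> nsets V 2" "v \<in> p" for p Q v
    using that sub by (auto simp: lab_def)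
  have inj: "inj_on lab (Pow (nsets V 2))"
  proof (rule inj_onI)
    fix Q Q' assume *: "Q \<in> Pow (nsets V 2)" "Q' \<in> Pow (nsets V 2)" "lab Q = lab Q'"
    have "p \<in> Q \<longleftrightarrow> p \<in> Q'" if p: "p \<in> nsets V 2" for p
    proof -
      obtain v where "v \<in> p" using sub[OF p] by blast
      then show ?thesis using lab_iff[OF p, of v Q] lab_iff[OF p, of v Q'] * by simp
    qed
    then show "Q = Q'" using * by blast
  qed
  have "(\<Sum>x\<in>PiE V (pair_labels V). (cmod (pair_amplitude \<alpha> \<beta> V x))\<^sup>2) =
      (\<Sum>x\<in>lab ` Pow (nsets V 2). (cmod (pair_amplitude \<alpha> \<beta> V x))\<^sup>2)"
  proof (rule sum.mono_neutral_right)
    show "finite (PiE V (pair_labels V))"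
      using assms by (intro finite_PiE finite_pair_labels) auto
    show "lab ` Pow (nsets V 2) \<subseteq> PiE V (pair_labels V)"
      by (auto simp: lab_def pair_labels_def)
    show "\<forall>x\<in>PiE V (pair_labels V) - lab ` Pow (nsets V 2). (cmod (pair_amplitude \<alpha> \<beta> V x))\<^sup>2 = 0"
    proof (rule ballI, rule ccontr)
      fix x assume x: "x \<in> PiE V (pair_labels V) - lab ` Pow (nsets V 2)"
        and nz: "(cmod (pair_amplitude \<alpha> \<beta> V x))\<^sup>2 \<noteq> 0"
      define Q where "Q = {p \<in> nsets V 2. \<forall>v\<in>p. p \<in> x v}"
      have "x v = lab Q v" for v
      proof (cases "v \<in> V")
        case True
        then have "x v \<in> pair_labels V v" using x PiE_mem by blast
        then have "x v \<subseteq> {p \<in> nsets V 2. v \<in> p}" by (simp add: pair_labels_def)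
        then have "x v = {p \<in> Q. v \<in> p}"
          using pair_amplitude_nonzero[OF assms, of \<alpha> \<beta> x] nz by (auto simp: Q_def)
        then show ?thesis using True by (simp add: lab_def)
      next
        case False
        then have "x v = undefined" using x PiE_arb[of x V "pair_labels V" v] by simp
        then show ?thesis using False by (simp add: lab_def)
      qed
      then have "x = lab Q" by (rule ext)
      moreover have "Q \<in> Pow (nsets V 2)" by (auto simp: Q_def)
      ultimately show False using x by blast
    qed
  qed
  also have "\<dots> = (\<Sum>Q\<in>Pow (nsets V 2). (cmod (pair_amplitude \<alpha> \<beta> V (lab Q)))\<^sup>2)"
    by (simp add: sum.reindex[OF inj])
  also have "\<dots> = (\<Sum>Q\<in>Pow (nsets V 2). (\<Prod>p\<in>Q. (cmod (\<beta> p))\<^sup>2) * (\<Prod>p\<in>nsets V 2 - Q. (cmod (\<alpha> p))\<^sup>2))"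
  proof (rule sum.cong[OF refl])
    fix Q assume Q: "Q \<in> Pow (nsets V 2)"
    have "pair_amplitude \<alpha> \<beta> V (lab Q) = (\<Prod>p\<in>nsets V 2. if p \<in> Q then \<beta> p else \<alpha> p)"
      unfolding pair_amplitude_def
    proof (rule prod.cong[OF refl])
      fix p assume p: "p \<in> nsets V 2"
      then show "(if \<forall>v\<in>p. p \<notin> lab Q v then \<alpha> p else if \<forall>v\<in>p. p \<in> lab Q v then \<beta> p else 0) =
          (if p \<in> Q then \<beta> p else \<alpha> p)"
        using lab_iff[OF p, of _ Q] sub[OF p] by auto
    qed
    also have "\<dots> = (\<Prod>p\<in>Q. \<beta> p) * (\<Prod>p\<in>nsets V 2 - Q. \<alpha> p)"
      using Q fin by (auto simp: prod.If_cases Int_absorb1 Diff_eq intro!: arg_cong2[where f = "(*)"] prod.cong)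
    finally show "(cmod (pair_amplitude \<alpha> \<beta> V (lab Q)))\<^sup>2 =
        (\<Prod>p\<in>Q. (cmod (\<beta> p))\<^sup>2) * (\<Prod>p\<in>nsets V 2 - Q. (cmod (\<alpha> p))\<^sup>2)"
      by (simp add: norm_mult prod_norm[symmetric] power_mult_distrib prod_power_distrib)
  qed
  also have "\<dots> = (\<Prod>p\<in>nsets V 2. (cmod (\<beta> p))\<^sup>2 + (cmod (\<alpha> p))\<^sup>2)"
    by (rule prod_add[OF fin, symmetric])
  finally show ?thesis by (simp add: add.commute)
qed

lemma retained_state_eq:
  "retained_state \<theta> V E = (pair_labels V,
     \<lambda>x y. retained_amplitude \<theta> V E x * cnj (retained_amplitude \<theta> V E y))"
  by (simp add: retained_state_def pair_labels_def fun_eq_iff)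

lemma pure_mixture_pure: "pure_mixture V (L, \<lambda>x y. \<psi> x * cnj (\<psi> y)) [\<psi>]"
  by (simp add: pure_mixture_def)

lemma branch_prob_pair_amplitude:
  assumes "finite V"
  shows "branch_prob V (pair_labels V, \<lambda>x y. pair_amplitude \<alpha> \<beta> V x * cnj (pair_amplitude \<alpha> \<beta> V y)) =
    (\<Prod>p\<in>nsets V 2. (cmod (\<alpha> p))\<^sup>2 + (cmod (\<beta> p))\<^sup>2)"
  using branch_prob_pure_mixture[OF pure_mixture_pure, of V "pair_labels V" "pair_amplitude \<alpha> \<beta> V"]
    norm_pair_amplitude_sum[OF assms, of \<alpha> \<beta>] by simp

lemma retained_schmidt_bounds:
  assumes "0 < \<theta>" "\<theta> < pi / 4"
  shows "1 / 2 \<le> retained_schmidt \<theta> E p" "retained_schmidt \<theta> E p \<le> 1"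
proof -
  have "0 < sin (2 * \<theta>)" using assms by (intro sin_gt_zero) auto
  then have "0 \<le> path_alpha \<theta> h" "path_alpha \<theta> h \<le> 1" for h
    by (auto simp: path_alpha_def power_le_one)
  then show "1 / 2 \<le> retained_schmidt \<theta> E p" "retained_schmidt \<theta> E p \<le> 1"
    by (auto simp: retained_schmidt_eq[OF assms] power_le_one)
qed

lemma branch_prob_retained_state:
  assumes "finite V" "0 < \<theta>" "\<theta> < pi / 4"
  shows "branch_prob V (retained_state \<theta> V E) = 1"
  unfolding retained_state_eq retained_amplitude_eq branch_prob_pair_amplitude[OF assms(1)]
proof (rule prod.neutral, rule ballI)
  fix p
  have "1 / 2 \<le> retained_schmidt \<theta> E p" "retained_schmidt \<theta> E p \<le> 1"
    using retained_schmidt_bounds[OF assms(2,3)] by auto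
  then show "(cmod (of_real (sqrt (retained_schmidt \<theta> E p))))\<^sup>2
      + (cmod (of_real (sqrt (1 - retained_schmidt \<theta> E p))))\<^sup>2 = 1"
    by simp
qed

text \<open>The trivial factorization: \<open>j\<close> runs over the labels of \<open>s\<close>,
  \<open>f\<close> tests for the label and \<open>g\<close> writes it back. Its size is 2 to the
  number of pairs at \<open>s\<close>.\<close>

lemma schmidt_bounded_retained_state:
  assumes "finite V" "s \<in> V"
  shows "schmidt_bounded V s (pair_labels V s) (retained_state \<theta> V E)"
proof -
  let ?\<psi> = "retained_amplitude \<theta> V E"
  have "?\<psi> x = (\<Sum>j\<in>pair_labels V s. of_bool (x s = j) * ?\<psi> ((x(s := {}))(s := j)))"
    if "x \<in> PiE V (pair_labels V)" for x
  proof -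
    have "(\<Sum>j\<in>pair_labels V s. of_bool (x s = j) * ?\<psi> ((x(s := {}))(s := j))) =
        (\<Sum>j\<in>pair_labels V s. if x s = j then ?\<psi> (x(s := j)) else 0)"
      by (intro sum.cong) auto
    then show ?thesis
      using PiE_mem[OF that assms(2)] finite_pair_labels[OF assms(1)] by simp
  qed
  then have "schmidt_factors V s (pair_labels V s) (pair_labels V) ?\<psi>"
    unfolding schmidt_factors_def
    by (intro exI[of _ "\<lambda>j c. of_bool (c = j)"] exI[of _ "\<lambda>j y. ?\<psi> (y(s := j))"]) blast
  then show ?thesis
    unfolding schmidt_bounded_def retained_state_eq
    by (intro exI[of _ "[?\<psi>]"] conjI pure_mixture_pure) simp
qed

text \<open>Branches of probability zero contribute nothing whatever their count; in all others the
  Schmidt bound limits the count, and the probabilities sum to one. Counting all pairs instead of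
  those at \<open>u\<close> costs only a polynomial factor.\<close>

lemma locc_ideal_pairs_le:
  assumes "finite V" "0 < \<theta>" "\<theta> < pi / 4" "p \<in> nsets V 2" "locc V (retained_state \<theta> V E) M"
  shows "(\<Sum>b\<in>#M. branch_prob V b * (d * real (ideal_pairs V p b))) \<le> \<bar>d\<bar> * real (card (nsets V 2))"
    and "b \<in># M \<Longrightarrow> 0 \<le> branch_prob V b"
proof -
  obtain u v where p: "p = {u, v}" "u \<noteq> v" "u \<in> V" "v \<in> V"
    using assms(4) by (rule pairE)
  note M = schmidt_bounded_locc[OF assms(5,1) _ schmidt_bounded_retained_state[OF assms(1) p(3)]]
  have fin: "\<forall>v\<in>V. finite (fst (retained_state \<theta> V E) v)"
    using finite_pair_labels[OF assms(1)] by (simp add: retained_state_eq)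
  have inv: "\<forall>v\<in>V. finite (fst b v)" "schmidt_bounded V u (pair_labels V u) b" if "b \<in># M" for b
    using bspec[OF conjunct1[OF M[OF fin]] that] by simp_all
  have one: "(\<Sum>b\<in>#M. branch_prob V b) = 1"
    using M[OF fin] branch_prob_retained_state[OF assms(1-3)] by simp
  show nonneg: "0 \<le> branch_prob V b" if "b \<in># M" for b
    by (rule branch_prob_nonneg[OF inv(2)[OF that]])
  have le: "ideal_pairs V p b \<le> card (nsets V 2)" if "b \<in># M" "branch_prob V b \<noteq> 0" for b
  proof -
    have "(2::nat) ^ ideal_pairs V p b \<le> card (pair_labels V u)"
      unfolding p(1)
      using inv[OF that(1)] that(2) p assms(1) finite_pair_labels[OF assms(1)]
      by (intro ideal_pairs_le) simp_all
    also have "\<dots> = 2 ^ card {p \<in> nsets V 2. u \<in> p}"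
      using assms(1) by (simp add: pair_labels_def card_Pow finite_imp_finite_nsets)
    finally have "ideal_pairs V p b \<le> card {p \<in> nsets V 2. u \<in> p}"
      by simp
    also have "\<dots> \<le> card (nsets V 2)"
      using assms(1) by (intro card_mono) (auto simp: finite_imp_finite_nsets)
    finally show ?thesis .
  qed
  have "(\<Sum>b\<in>#M. branch_prob V b * (d * real (ideal_pairs V p b))) \<le>
      (\<Sum>b\<in>#M. branch_prob V b * (\<bar>d\<bar> * real (card (nsets V 2))))"
  proof (rule sum_mset_mono)
    fix b assume b: "b \<in># M"
    have "d * real (ideal_pairs V p b) \<le> \<bar>d\<bar> * real (card (nsets V 2))" if "branch_prob V b \<noteq> 0"
      using le[OF b that] by (intro mult_mono) auto
    then show "branch_prob V b * (d * real (ideal_pairs V p b)) \<le>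
        branch_prob V b * (\<bar>d\<bar> * real (card (nsets V 2)))"
      using nonneg[OF b] by (cases "branch_prob V b = 0") (auto intro: mult_left_mono)
  qed
  also have "\<dots> = (\<Sum>b\<in>#M. branch_prob V b) * (\<bar>d\<bar> * real (card (nsets V 2)))"
    by (simp add: sum_mset_distrib_right)
  finally show "(\<Sum>b\<in>#M. branch_prob V b * (d * real (ideal_pairs V p b))) \<le> \<bar>d\<bar> * real (card (nsets V 2))"
    using one by simp
qed

text \<open>Local filtering: damping the larger Schmidt coefficient to the smaller one makes the pair
  maximally entangled.\<close>

lemma locc_singlet_conversion:
  assumes "finite V" "0 < \<theta>" "\<theta> < pi / 4" "p \<in> nsets V 2" "retained_schmidt \<theta> E p < 1"
  obtains M where "locc V (retained_state \<theta> V E) M"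
    and "2 * (1 - retained_schmidt \<theta> E p) \<le> (\<Sum>b\<in>#M. branch_prob V b * real (ideal_pairs V p b))"
proof -
  obtain u v where p: "p = {u, v}" "u \<noteq> v" "u \<in> V" "v \<in> V"
    using assms(4) by (rule pairE)
  define \<mu> where "\<mu> = retained_schmidt \<theta> E p"
  have \<mu>: "1 / 2 \<le> \<mu>" "\<mu> < 1" using retained_schmidt_bounds[OF assms(2,3)] assms(5) by (auto simp: \<mu>_def)
  \<comment> \<open>The ratio of the two Schmidt amplitudes of \<open>p\<close>. It is at most one
    because \<open>\<mu>\<close> is the larger squared coefficient, so damping by \<open>t\<close>
    is a contraction.\<close>
  define t where "t = sqrt ((1 - \<mu>) / \<mu>)"
  have t: "0 \<le> t" "t\<^sup>2 \<le> 1" "t * sqrt \<mu> = sqrt (1 - \<mu>)"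
    using \<mu> by (auto simp: t_def real_sqrt_mult[symmetric] field_simps)
  \<comment> \<open>\<open>True\<close> is success. The failure operator is the diagonal complement
    that restores completeness.\<close>
  define K :: "bool \<Rightarrow> 'a set kraus" where
    "K i a b = of_bool (a = b) * of_real (if i then (if p \<in> a then 1 else t)
       else (if p \<in> a then 0 else sqrt (1 - t\<^sup>2)))" for i a b
  define A where "A = pair_labels V u"
  define I where "I = [(A, [K True]), (A, [K False])]"
  define \<psi> where "\<psi> = retained_amplitude \<theta> V E"
  define S where "S = retained_state \<theta> V E"
  define \<rho> where "\<rho> i = apply_kraus u A [K i] (snd S)" for i
  have finA: "finite A" using finite_pair_labels[OF assms(1)] by (simp add: A_def)
  have S: "S = (pair_labels V, \<lambda>x y. \<psi> x * cnj (\<psi> y))"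
    by (simp add: S_def \<psi>_def retained_state_eq)
  have "instrument A I"
    unfolding instrument_def
  proof (rule conjI, goal_cases)
    case 1
    show ?case using finA by (simp add: I_def)
  next
    case 2
    show ?case
    proof (intro ballI)
      fix a b assume ab: "a \<in> A" "b \<in> A"
      have "(\<Sum>c\<in>A. cnj (K i c a) * K i c b) = (\<Sum>c\<in>A. if c = a then cnj (K i a a) * K i a b else 0)" for i
        by (intro sum.cong) (auto simp: K_def)
      then have *: "(\<Sum>c\<in>A. cnj (K i c a) * K i c b) = cnj (K i a a) * K i a b" for i
        using ab finA by simp
      have "t * t + sqrt (1 - t\<^sup>2) * sqrt (1 - t\<^sup>2) = 1"
        using t(2) by (simp add: power2_eq_square)
      then have "complex_of_real t * complex_of_real t
          + complex_of_real (sqrt (1 - t\<^sup>2)) * complex_of_real (sqrt (1 - t\<^sup>2)) = 1"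
        by (simp only: of_real_1 flip: of_real_add of_real_mult)
      then have "cnj (K True a a) * K True a b + cnj (K False a a) * K False a b = of_bool (a = b)"
        by (simp add: K_def)
      then show "(\<Sum>(A', Ks)\<leftarrow>I. \<Sum>K\<leftarrow>Ks. \<Sum>c\<in>A'. cnj (K c a) * K c b) = of_bool (a = b)"
        by (simp add: I_def *)
    qed
  qed
  then have "locc V S ({#} + mset (map (\<lambda>(A', Ks). ((pair_labels V)(u := A'),
      apply_kraus u (pair_labels V u) Ks (snd S))) I))"
    using p(3) by (intro locc.local_step) (simp_all add: S A_def locc.start[of V S, unfolded S])
  then have locc: "locc V S {#(pair_labels V, \<rho> True), (pair_labels V, \<rho> False)#}"
    by (simp add: I_def \<rho>_def A_def)
  \<comment> \<open>The filtered vector: both amplitudes of \<open>p\<close> are now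
    \<open>sqrt (1 - \<mu>)\<close>, so its squared norm \<open>2 * (1 - \<mu>)\<close> is the
    success probability.\<close>
  define \<psi>' where "\<psi>' = pair_amplitude ((\<lambda>q. of_real (sqrt (retained_schmidt \<theta> E q)))(p := of_real (sqrt (1 - \<mu>))))
     (\<lambda>q. of_real (sqrt (1 - retained_schmidt \<theta> E q))) V"
  have fin2: "finite (nsets V 2)" using assms(1) by (simp add: finite_imp_finite_nsets)
  define \<kappa> where "\<kappa> c = complex_of_real (if p \<in> c then 1 else t)" for c
  have K_True: "K True c b = of_bool (c = b) * \<kappa> c" for c b
    by (simp add: K_def \<kappa>_def)
  have filt: "\<kappa> (x u) * \<psi> x = \<psi>' x" for x
  proof -
    let ?F = "\<lambda>\<alpha> q. if \<forall>w\<in>q. q \<notin> x w then \<alpha> q else if \<forall>w\<in>q. q \<in> x w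
      then complex_of_real (sqrt (1 - retained_schmidt \<theta> E q)) else 0"
    let ?\<alpha> = "\<lambda>q. complex_of_real (sqrt (retained_schmidt \<theta> E q))"
    let ?\<alpha>' = "?\<alpha>(p := of_real (sqrt (1 - \<mu>)))"
    have "\<psi> x = ?F ?\<alpha> p * (\<Prod>q\<in>nsets V 2 - {p}. ?F ?\<alpha> q)"
      unfolding \<psi>_def retained_amplitude_eq pair_amplitude_def by (rule prod.remove[OF fin2 assms(4)])
    moreover have "\<psi>' x = ?F ?\<alpha>' p * (\<Prod>q\<in>nsets V 2 - {p}. ?F ?\<alpha>' q)"
      unfolding \<psi>'_def pair_amplitude_def by (rule prod.remove[OF fin2 assms(4)])
    moreover have "(\<Prod>q\<in>nsets V 2 - {p}. ?F ?\<alpha>' q) = (\<Prod>q\<in>nsets V 2 - {p}. ?F ?\<alpha> q)"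
      by (rule prod.cong) simp_all
    moreover have "\<kappa> (x u) * ?F ?\<alpha> p = ?F ?\<alpha>' p"
    proof (cases "p \<in> x u")
      case True
      then have *: "\<not> (\<forall>w\<in>p. p \<notin> x w)" using p(1) by blast
      show ?thesis by (simp only: \<kappa>_def * True if_True if_False of_real_1 mult_1_left)
    next
      case False
      then have *: "\<not> (\<forall>w\<in>p. p \<in> x w)" using p(1) by blast
      have **: "complex_of_real t * of_real (sqrt (retained_schmidt \<theta> E p)) = of_real (sqrt (1 - \<mu>))"
        unfolding of_real_mult[symmetric] \<mu>_def[symmetric] t(3) ..
      show ?thesis
      proof (cases "\<forall>w\<in>p. p \<notin> x w")
        case all: True
        show ?thesis by (simp only: \<kappa>_def False if_False if_P[OF all] fun_upd_same **)
      next
        case some: False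
        show ?thesis by (simp only: if_not_P[OF some] if_not_P[OF *] mult_zero_right)
      qed
    qed
    ultimately show ?thesis by (simp only: mult.assoc[symmetric])
  qed
  have "pure_mixture V (pair_labels V, \<rho> True) [\<psi>']"
    unfolding pure_mixture_def fst_conv snd_conv
  proof (intro ballI)
    fix x y assume "x \<in> PiE V (pair_labels V)" "y \<in> PiE V (pair_labels V)"
    then have "x u \<in> A" "y u \<in> A" using p(3) by (auto simp: A_def)
    have "\<rho> True x y = (\<Sum>a\<in>A. \<Sum>b\<in>A. if b = y u then if a = x u then
        (\<kappa> (x u) * \<psi> x) * cnj (\<kappa> (y u) * \<psi> y) else 0 else 0)"
      unfolding \<rho>_def apply_kraus_def S K_True by (auto intro!: sum.cong)
    also have "\<dots> = \<psi>' x * cnj (\<psi>' y)"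
      using finA \<open>x u \<in> A\<close> \<open>y u \<in> A\<close> by (simp add: filt)
    finally show "\<rho> True x y = (\<Sum>\<psi>\<leftarrow>[\<psi>']. \<psi> x * cnj (\<psi> y))" by simp
  qed
  note mix = this
  have "branch_prob V (pair_labels V, \<rho> True) = (\<Prod>q\<in>nsets V 2. if q = p then 2 * (1 - \<mu>) else 1)"
  proof -
    have "branch_prob V (pair_labels V, \<rho> True) = (\<Sum>x\<in>PiE V (pair_labels V). (cmod (\<psi>' x))\<^sup>2)"
      by (simp add: branch_prob_pure_mixture[OF mix])
    also have "\<dots> = (\<Prod>q\<in>nsets V 2. if q = p then 2 * (1 - \<mu>) else 1)"
      unfolding \<psi>'_def norm_pair_amplitude_sum[OF assms(1)]
    proof (rule prod.cong[OF refl])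
      fix q
      show "(cmod (((\<lambda>q. of_real (sqrt (retained_schmidt \<theta> E q)))(p := of_real (sqrt (1 - \<mu>)))) q))\<^sup>2
        + (cmod (of_real (sqrt (1 - retained_schmidt \<theta> E q))))\<^sup>2 = (if q = p then 2 * (1 - \<mu>) else 1)"
        using retained_schmidt_bounds[OF assms(2,3), of E q] \<mu> by (simp add: \<mu>_def)
    qed
    finally show ?thesis .
  qed
  then have prob: "branch_prob V (pair_labels V, \<rho> True) = 2 * (1 - \<mu>)"
    using fin2 assms(4) by simp
  have q: "is_qubit (pair_labels V w) r \<longleftrightarrow> r \<in> nsets V 2 \<and> w \<in> r" for w r
    by (auto simp: is_qubit_def pair_labels_def)
  have "bell_fidelity V {u, v} p (pair_labels V, \<rho> True) = 1"
  proof (subst bell_fidelity_eq_1_iff[OF assms(1) _ p(3,4,2) _ _ mix])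
    have "bell_deficit u v p \<psi>' x = 0" if "p \<notin> x u" "p \<notin> x v" for x
    proof -
      have z: "\<psi>' y = 0" if "(p \<in> y u) \<noteq> (p \<in> y v)" for y
        using pair_amplitude_nonzero[OF assms(1) _ assms(4), of _ _ y] that p(1) unfolding \<psi>'_def by blast
      have "\<psi>' (x(u := insert p (x u), v := insert p (x v))) = \<psi>' x"
        unfolding \<psi>'_def pair_amplitude_def using that p(1,2)
        by (intro prod.cong) (auto simp: \<mu>_def)
      then show ?thesis using that p(2) by (simp add: bell_deficit_def z)
    qed
    then show "branch_prob V (pair_labels V, \<rho> True) \<noteq> 0 \<and>
        (\<forall>\<psi>\<in>set [\<psi>']. \<forall>x\<in>PiE V (pair_labels V). p \<notin> x u \<longrightarrow> p \<notin> x v \<longrightarrow> bell_deficit u v p \<psi> x = 0)"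
      using prob \<mu> by simp
  qed (use q p assms in \<open>auto simp: finite_pair_labels\<close>)
  then have "p \<in> {r. (\<forall>w\<in>p. is_qubit (pair_labels V w) r) \<and> bell_fidelity V p r (pair_labels V, \<rho> True) = 1}"
    using q assms(4) p(1) by simp
  \<comment> \<open>Needed because \<open>card\<close> would return 0 on an infinite set; the only
    qubits are the registers of node pairs.\<close>
  moreover have "finite {r. (\<forall>w\<in>p. is_qubit (pair_labels V w) r) \<and> bell_fidelity V p r (pair_labels V, \<rho> True) = 1}"
    by (rule finite_subset[OF _ fin2]) (auto simp: q p(1))
  ultimately have ideal: "1 \<le> ideal_pairs V p (pair_labels V, \<rho> True)"
    by (auto simp: ideal_pairs_def Suc_le_eq card_gt_0_iff)
  \<comment> \<open>The failure branch needs no analysis: its contribution is nonnegative.\<close>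
  have "0 \<le> branch_prob V (pair_labels V, \<rho> False)"
    using locc_ideal_pairs_le(2)[OF assms(1-4) locc[unfolded S_def]] by simp
  then have "2 * (1 - \<mu>) * 1 + 0 \<le> (\<Sum>b\<in>#{#(pair_labels V, \<rho> True), (pair_labels V, \<rho> False)#}.
      branch_prob V b * real (ideal_pairs V p b))"
    using ideal \<mu> unfolding image_mset_add_mset sum_mset.add_mset prob
    by (intro add_mono mult_mono) auto
  then show ?thesis using that[OF locc[unfolded S_def]] by (simp add: \<mu>_def)
qed


subsection \<open>Rates\<close>

lemma phys_dist_pair: "phys_dist a {u, v} = dist (honeycomb_pos a u) (honeycomb_pos a v)"
  unfolding phys_dist_def
proof (rule the_equality)
  show "\<exists>u' v'. {u, v} = {u', v'} \<and>
      dist (honeycomb_pos a u) (honeycomb_pos a v) = dist (honeycomb_pos a u') (honeycomb_pos a v')"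
    by blast
qed (auto simp: doubleton_eq_iff dist_commute)

text \<open>The three offsets from a neighbour to a vertex of sublattice 1 are
  \<open>(sqrt 3 / 2, 1 / 2)\<close>, \<open>(- sqrt 3 / 2, 1 / 2)\<close> and
  \<open>(0, -1)\<close> times \<open>a\<close>, all of length \<open>a\<close>.\<close>

lemma dist_honeycomb_edge:
  assumes "{u, v} \<in> honeycomb_edges" "0 \<le> a"
  shows "dist (honeycomb_pos a u) (honeycomb_pos a v) = a"
proof -
  have edge: "dist (honeycomb_pos a (i, j, True)) (honeycomb_pos a w) = a"
    if "w \<in> {(i, j, False), (i + 1, j, False), (i, j + 1, False)}" for i j w
  proof -
    have sqrt3: "sqrt 3 * (sqrt 3 * x) = 3 * x" for x :: real
      by (simp flip: mult.assoc)
    have "(cmod (honeycomb_pos a (i, j, True) - honeycomb_pos a w))\<^sup>2 = a\<^sup>2"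
      using that unfolding cmod_power2
      by (auto simp: honeycomb_pos_def power2_eq_square field_simps sqrt3)
    then show ?thesis using assms(2) by (simp add: dist_norm power2_eq_iff_nonneg)
  qed
  from assms(1) obtain i j w where w: "w \<in> {(i, j, False), (i + 1, j, False), (i, j + 1, False)}"
    and "{u, v} = {(i, j, True), w}"
    unfolding honeycomb_edges_def by blast
  then show ?thesis using edge[OF w] by (auto simp: doubleton_eq_iff dist_commute)
qed

lemma dist_honeycomb_path:
  assumes "successively (\<lambda>u v. {u, v} \<in> honeycomb_edges) xs" "xs \<noteq> []" "0 \<le> a"
  shows "dist (honeycomb_pos a (hd xs)) (honeycomb_pos a (last xs)) \<le> a * real (length xs)"
  using assms
proof (induction xs rule: induct_list012)
  case (3 u v xs)
  have "dist (honeycomb_pos a u) (honeycomb_pos a (last (v # xs))) \<le>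
      dist (honeycomb_pos a u) (honeycomb_pos a v) + dist (honeycomb_pos a v) (honeycomb_pos a (last (v # xs)))"
    by (rule dist_triangle)
  then show ?case
    using 3 dist_honeycomb_edge[of u v a] by (simp add: algebra_simps)
qed auto

lemma phys_dist_nonneg: "p \<in> nsets V 2 \<Longrightarrow> 0 \<le> phys_dist a p"
  by (elim pairE) (simp add: phys_dist_pair)

text \<open>A path visits each vertex at most once and every hop has length \<open>a\<close>. The
  resulting bound is linear in \<open>N\<close> instead of \<open>sqrt N\<close>, which is enough up
  to polynomial factors.\<close>

lemma phys_dist_le:
  assumes "honeycomb_piece V E" "p \<in> nsets V 2" "0 \<le> a"
  shows "phys_dist a p \<le> a * real (card V)"
proof -
  obtain xs where xs: "is_path E p xs" using assms by (auto simp: honeycomb_piece_def)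
  have E: "E \<subseteq> honeycomb_edges" "E \<subseteq> nsets V 2" "finite V" using assms(1) by (auto simp: honeycomb_piece_def)
  have p2: "card p = 2" using assms(2) by (simp add: nsets_def)
  have p: "p = {hd xs, last xs}" using xs by (simp add: is_path_def)
  have "successively (\<lambda>u v. {u, v} \<in> honeycomb_edges) xs" "xs \<noteq> []"
    using xs E by (auto simp: is_path_def elim!: successively_mono)
  then have "phys_dist a p \<le> a * real (length xs)"
    unfolding p phys_dist_pair using assms(3) by (rule dist_honeycomb_path)
  moreover have "length xs \<le> card V"
    using distinct_card[of xs] card_mono[OF E(3) is_path_subset[OF E(2) xs p2]] xs
    by (simp add: is_path_def)
  ultimately show ?thesis using assms(3) by (meson mult_left_mono of_nat_mono order_trans)
qed

lemma card_nsets_2_le: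
  assumes "finite V"
  shows "card (nsets V 2) \<le> (card V)\<^sup>2"
proof -
  have "nsets V 2 \<subseteq> (\<lambda>(u, v). {u, v}) ` (V \<times> V)"
    by (force elim!: pairE)
  then have "card (nsets V 2) \<le> card (V \<times> V)"
    using assms by (meson card_image_le card_mono finite_SigmaI finite_imageI order_trans)
  then show ?thesis by (simp add: card_cartesian_product power2_eq_square)
qed

lemma divide_card_nsets_2_le:
  assumes "finite V" "nsets V 2 \<noteq> {}" "0 \<le> c"
  shows "c / real ((card V)\<^sup>2) \<le> c / real (card (nsets V 2))"
proof (rule divide_left_mono)
  have "0 < card (nsets V 2)"
    using assms(1,2) by (subst card_gt_0_iff) (auto intro: finite_imp_finite_nsets)
  moreover have "card (nsets V 2) \<le> (card V)\<^sup>2"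
    by (rule card_nsets_2_le[OF assms(1)])
  ultimately show "real (card (nsets V 2)) \<le> real ((card V)\<^sup>2)"
    and "0 < real ((card V)\<^sup>2) * real (card (nsets V 2))"
    by (simp_all only: of_nat_le_iff of_nat_0_less_iff of_nat_mult[symmetric] nat_0_less_mult_iff) simp_all
qed fact

lemma honeycomb_pieceD:
  assumes "honeycomb_piece V E"
  shows "finite V" "finite E" "E \<noteq> {}" "E \<subseteq> honeycomb_edges" "E \<subseteq> nsets V 2"
    "finite (nsets V 2)" "nsets V 2 \<noteq> {}"
proof -
  show V: "finite V" and "E \<subseteq> honeycomb_edges" "E \<subseteq> nsets V 2"
    using assms by (auto simp: honeycomb_piece_def)
  then show "finite (nsets V 2)" and "finite E"
    by (auto simp: finite_imp_finite_nsets intro: finite_subset)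
  have "2 \<le> card V" using assms by (simp add: honeycomb_piece_def)
  then obtain p where "p \<subseteq> V" "card p = 2" "finite p" using obtain_subset_with_card_n by metis
  then have p: "p \<in> nsets V 2" by (simp add: nsets_def)
  then show "nsets V 2 \<noteq> {}" by blast
  obtain xs where xs: "is_path E p xs" using assms p by (auto simp: honeycomb_piece_def)
  then have "2 \<le> length xs" using is_path_pair_length \<open>card p = 2\<close> by blast
  then have "path_edges xs \<noteq> {}"
    by (auto simp: path_edges_def intro!: exI[of _ 0])
  moreover have "path_edges xs \<subseteq> E" using xs by (simp add: is_path_def path_edges_subset)
  ultimately show "E \<noteq> {}" by blast
qed

text \<open>The singlet conversion probability of a link; for \<theta> in the given range it equals
  \<open>1 - cos (2 * \<theta>)\<close>. It does not depend on the graph.\<close>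

definition edge_success :: "real \<Rightarrow> real" where
  "edge_success \<theta> = 1 - sqrt (1 - (sin (2 * \<theta>))\<^sup>2)"

lemma edge_success_bounds:
  assumes "0 < \<theta>" "\<theta> < pi / 4"
  shows "0 < edge_success \<theta>" "edge_success \<theta> \<le> 1"
proof -
  have "0 < sin (2 * \<theta>)" using assms by (intro sin_gt_zero) auto
  moreover have "(sin (2 * \<theta>))\<^sup>2 \<le> 1" by (simp add: abs_square_le_1)
  ultimately show "0 < edge_success \<theta>" "edge_success \<theta> \<le> 1"
    by (auto simp: edge_success_def)
qed

lemma retained_schmidt_edge:
  assumes "0 < \<theta>" "\<theta> < pi / 4" "E \<subseteq> nsets V 2" "e \<in> E"
  shows "2 * (1 - retained_schmidt \<theta> E e) = edge_success \<theta>"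
proof -
  obtain u v where uv: "e = {u, v}" "u \<noteq> v" using assms(3,4) by (meson pairE subsetD)
  have "(sin (2 * \<theta>))\<^sup>2 \<le> 1" by (simp add: abs_square_le_1)
  then show ?thesis
    using uv assms(4)
    by (simp add: retained_schmidt_eq[OF assms(1,2)] hop_dist_edge shortest_paths_edge path_alpha_def
        edge_success_def max_def field_simps power2_eq_square)
qed

lemma phys_dist_edge:
  assumes "E \<subseteq> honeycomb_edges \<inter> nsets V 2" "e \<in> E" "0 \<le> a"
  shows "phys_dist a e = a"
proof -
  obtain u v where "e = {u, v}" using assms by (meson le_inf_iff pairE subsetD)
  then show ?thesis using assms dist_honeycomb_edge[of u v a] by (auto simp: phys_dist_pair)
qed

section \<open>Averages over the session and bounds on both rates\<close>

lemma avg_bounds: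
  fixes f :: "'a \<Rightarrow> real"
  assumes "finite A" "A \<noteq> {}"
  shows "(\<And>x. x \<in> A \<Longrightarrow> f x \<le> c) \<Longrightarrow> measure_pmf.expectation (pmf_of_set A) f \<le> c"
    and "(\<And>x. x \<in> A \<Longrightarrow> 0 \<le> f x) \<Longrightarrow> y \<in> A \<Longrightarrow> f y / real (card A) \<le> measure_pmf.expectation (pmf_of_set A) f"
proof -
  have card: "0 < real (card A)" using assms by (simp add: card_gt_0_iff)
  show "measure_pmf.expectation (pmf_of_set A) f \<le> c" if "\<And>x. x \<in> A \<Longrightarrow> f x \<le> c"
    using sum_bounded_above[of A f c] that card
    by (simp add: integral_pmf_of_set[OF assms(2,1)] field_simps)
  show "f y / real (card A) \<le> measure_pmf.expectation (pmf_of_set A) f"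
    if "\<And>x. x \<in> A \<Longrightarrow> 0 \<le> f x" "y \<in> A"
    unfolding integral_pmf_of_set[OF assms(2,1)]
    using member_le_sum[of y A f] that assms(1) by (intro divide_right_mono) auto
qed

text \<open>The cube collects one factor \<open>N\<close> from the distance and \<open>N ^ 2\<close>
  from the number of pairs.\<close>

lemma locc_rate_le:
  assumes "honeycomb_piece V E" "0 < \<theta>" "\<theta> < pi / 4" "0 \<le> a"
    and "\<forall>p \<in> nsets V 2. locc V (retained_state \<theta> V E) (\<sigma> p)"
  shows "locc_rate a V E \<sigma> \<le> a * real (card V) ^ 3 / real (min_window V E)"
proof -
  note piece = honeycomb_pieceD[OF assms(1)]
  have "(\<Sum>b\<in>#\<sigma> p. branch_prob V b * (phys_dist a p * real (ideal_pairs V p b))) \<le> a * real (card V) ^ 3"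
    if p: "p \<in> nsets V 2" for p
  proof -
    have "(\<Sum>b\<in>#\<sigma> p. branch_prob V b * (phys_dist a p * real (ideal_pairs V p b)))
        \<le> \<bar>phys_dist a p\<bar> * real (card (nsets V 2))"
      using assms p piece by (intro locc_ideal_pairs_le) auto
    also have "\<dots> \<le> (a * real (card V)) * real ((card V)\<^sup>2)"
      using phys_dist_le[OF assms(1) p assms(4)] phys_dist_nonneg[OF p] card_nsets_2_le[OF piece(1)] assms(4)
      by (intro mult_mono of_nat_mono) auto
    finally show ?thesis by (simp add: power2_eq_square power3_eq_cube mult_ac)
  qed
  then have "measure_pmf.expectation (pmf_of_set (nsets V 2))
      (\<lambda>p. \<Sum>b\<in>#\<sigma> p. branch_prob V b * (phys_dist a p * real (ideal_pairs V p b))) \<le> a * real (card V) ^ 3"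
    using piece by (intro avg_bounds)
  then show ?thesis
    by (simp add: locc_rate_def divide_right_mono)
qed

text \<open>The strategy filters only when the session is one chosen edge \<open>e\<close> and
  otherwise leaves the state alone. All other sessions contribute nonnegatively, and the session
  \<open>e\<close> alone gives the bound.\<close>

lemma locc_rate_ge:
  assumes "honeycomb_piece V E" "0 < \<theta>" "\<theta> < pi / 4" "0 \<le> a"
  obtains \<sigma> where "\<forall>p \<in> nsets V 2. locc V (retained_state \<theta> V E) (\<sigma> p)"
    and "a * edge_success \<theta> / (real (card V) ^ 2 * real (min_window V E)) \<le> locc_rate a V E \<sigma>"
proof -
  note piece = honeycomb_pieceD[OF assms(1)]
  obtain e where e: "e \<in> E" "e \<in> nsets V 2" using piece by blast
  note edge = retained_schmidt_edge[OF assms(2,3) piece(5) e(1)]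
  have "retained_schmidt \<theta> E e < 1" using edge edge_success_bounds[OF assms(2,3)] by simp
  from locc_singlet_conversion[OF piece(1) assms(2,3) e(2) this]
  obtain M where M: "locc V (retained_state \<theta> V E) M"
    "edge_success \<theta> \<le> (\<Sum>b\<in>#M. branch_prob V b * real (ideal_pairs V e b))"
    unfolding edge by blast
  define \<sigma> where "\<sigma> p = (if p = e then M else {#retained_state \<theta> V E#})" for p
  have \<sigma>: "locc V (retained_state \<theta> V E) (\<sigma> p)" for p
    using M by (simp add: \<sigma>_def locc.start)
  let ?f = "\<lambda>p. \<Sum>b\<in>#\<sigma> p. branch_prob V b * (phys_dist a p * real (ideal_pairs V p b))"
  have "0 \<le> ?f p" if p: "p \<in> nsets V 2" for p
  proof -
    have "(\<Sum>b\<in>#\<sigma> p. 0) \<le> ?f p"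
    proof (rule sum_mset_mono)
      fix b assume "b \<in># \<sigma> p"
      then have "0 \<le> branch_prob V b"
        using locc_ideal_pairs_le(2)[OF piece(1) assms(2,3) p \<sigma>] by blast
      then show "0 \<le> branch_prob V b * (phys_dist a p * real (ideal_pairs V p b))"
        using phys_dist_nonneg[OF p] by simp
    qed
    then show ?thesis by simp
  qed
  then have "?f e / real (card (nsets V 2)) \<le> measure_pmf.expectation (pmf_of_set (nsets V 2)) ?f"
    using piece e by (intro avg_bounds)
  moreover have "?f e = a * (\<Sum>b\<in>#M. branch_prob V b * real (ideal_pairs V e b))"
    using phys_dist_edge[of E V e a] piece e assms(4)
    by (simp add: \<sigma>_def sum_mset_distrib_left mult_ac)
  then have "a * edge_success \<theta> \<le> ?f e"
    using M(2) assms(4) by (simp add: mult_left_mono)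
  then have "a * edge_success \<theta> / real (card (nsets V 2)) \<le> ?f e / real (card (nsets V 2))"
    by (rule divide_right_mono) simp
  moreover have "a * edge_success \<theta> / real ((card V)\<^sup>2) \<le> a * edge_success \<theta> / real (card (nsets V 2))"
    using assms(4) edge_success_bounds[OF assms(2,3)]
    by (intro divide_card_nsets_2_le[OF piece(1,7)]) simp
  ultimately have "a * edge_success \<theta> / real ((card V)\<^sup>2) \<le> measure_pmf.expectation (pmf_of_set (nsets V 2)) ?f"
    by linarith
  then have "1 / real (min_window V E) * (a * edge_success \<theta> / real ((card V)\<^sup>2)) \<le> locc_rate a V E \<sigma>"
    unfolding locc_rate_def by (intro mult_left_mono) auto
  then have "a * edge_success \<theta> / (real (card V) ^ 2 * real (min_window V E)) \<le> locc_rate a V E \<sigma>"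
    by (simp add: mult_ac)
  with \<sigma> show ?thesis using that by blast
qed

lemma optimal_locc_rate_bounds:
  assumes "honeycomb_piece V E" "0 < \<theta>" "\<theta> < pi / 4" "0 \<le> a"
  obtains r where "optimal_locc_rate a \<theta> V E = ereal r"
    and "a * edge_success \<theta> / (real (card V) ^ 2 * real (min_window V E)) \<le> r"
    and "r \<le> a * real (card V) ^ 3 / real (min_window V E)"
proof -
  obtain \<sigma> where \<sigma>: "\<forall>p \<in> nsets V 2. locc V (retained_state \<theta> V E) (\<sigma> p)"
    and low: "a * edge_success \<theta> / (real (card V) ^ 2 * real (min_window V E)) \<le> locc_rate a V E \<sigma>"
    using locc_rate_ge[OF assms] .
  have up: "optimal_locc_rate a \<theta> V E \<le> ereal (a * real (card V) ^ 3 / real (min_window V E))"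
    unfolding optimal_locc_rate_def using locc_rate_le[OF assms] by (intro SUP_least) auto
  have "ereal (locc_rate a V E \<sigma>) \<le> optimal_locc_rate a \<theta> V E"
    unfolding optimal_locc_rate_def using \<sigma> by (intro SUP_upper) auto
  moreover from calculation up obtain r where r: "optimal_locc_rate a \<theta> V E = ereal r"
    by (cases "optimal_locc_rate a \<theta> V E") simp_all
  ultimately show ?thesis using up low by (intro that[of r]) simp_all
qed

text \<open>Routed paths are disjoint and nonempty, so choosing one Bell pair from each is injective
  into \<open>B\<close>. Conversely a direct Bell pair is a path with one edge.\<close>

lemma max_routing_bounds:
  assumes "finite B" "card p = 2"
  shows "max_routing B p \<le> card B"
    and "p \<in> B \<Longrightarrow> 1 \<le> max_routing B p"
proof -
  let ?P = "{path_edges xs | xs. is_path B p xs}"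
  let ?C = "{card F | F. F \<subseteq> ?P \<and> pairwise disjnt F}"
  have P: "P \<subseteq> B \<and> P \<noteq> {}" if "P \<in> ?P" for P
  proof -
    from that obtain xs where xs: "P = path_edges xs" "is_path B p xs" by blast
    have "2 \<le> length xs" using is_path_pair_length[OF xs(2) assms(2)] .
    then have "P \<noteq> {}" using Union_path_edges[of xs] xs(1) by auto
    moreover have "P \<subseteq> B" using xs by (simp add: is_path_def path_edges_subset)
    ultimately show ?thesis by simp
  qed
  have card_le: "card F \<le> card B" if F: "F \<subseteq> ?P" "pairwise disjnt F" for F
  proof -
    define pick where "pick P = (SOME x. x \<in> P)" for P :: "'a set set"
    have pick: "pick P \<in> P" if "P \<in> F" for P
      using P[OF subsetD[OF F(1) that]] by (simp add: pick_def some_in_eq)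
    have "inj_on pick F"
    proof (rule inj_onI)
      fix P Q assume PQ: "P \<in> F" "Q \<in> F" "pick P = pick Q"
      then have "\<not> disjnt P Q" using pick[of P] pick[of Q] by (auto simp: disjnt_def)
      then show "P = Q" using F(2) PQ by (auto simp: pairwise_def)
    qed
    moreover have "pick ` F \<subseteq> B"
      using pick P[OF subsetD[OF F(1)]] by (intro image_subsetI) blast
    ultimately show ?thesis using assms(1) card_inj_on_le by blast
  qed
  have fin: "finite ?C"
    by (rule finite_subset[of _ "{..card B}"]) (use card_le in auto)
  have ne: "0 \<in> ?C" by (rule CollectI, rule exI[of _ "{}"]) simp
  show "max_routing B p \<le> card B"
    unfolding max_routing_def using fin ne card_le by (subst Max_le_iff) auto
  show "1 \<le> max_routing B p" if "p \<in> B"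
  proof -
    obtain u v where uv: "p = {u, v}" "u \<noteq> v" using assms(2) by (auto simp: card_2_iff)
    have "path_edges [u, v] \<in> ?P" using is_path_edge[of u v B] uv that by auto
    then have "1 \<in> ?C" by (intro CollectI exI[of _ "{path_edges [u, v]}"]) auto
    then show ?thesis unfolding max_routing_def using fin by (rule Max_ge[rotated])
  qed
qed

text \<open>A marginal of the product distribution. The event is confined to subsets of
  \<open>nsets V 2\<close> to be a finite set, since the product formula for \<open>pair_pmf\<close>
  is later applied to countable events.\<close>

lemma prob_bell_graph:
  assumes "finite V" "p \<in> nsets V 2" "0 \<le> singlet_prob \<theta> E p" "singlet_prob \<theta> E p \<le> 1"
  shows "measure_pmf.prob (bell_graph_pmf \<theta> V E) {B. B \<subseteq> nsets V 2 \<and> p \<in> B} = singlet_prob \<theta> E p"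
proof -
  let ?Pi = "Pi_pmf (nsets V 2) False (\<lambda>p. bernoulli_pmf (singlet_prob \<theta> E p))"
  have "measure_pmf.prob (bell_graph_pmf \<theta> V E) {B. B \<subseteq> nsets V 2 \<and> p \<in> B} = measure_pmf.prob ?Pi ((\<lambda>f. f p) -` {True})"
    unfolding bell_graph_pmf_def measure_map_pmf using assms(2)
    by (intro arg_cong[where f = "measure_pmf.prob ?Pi"]) auto
  also have "\<dots> = measure_pmf.prob (map_pmf (\<lambda>f. f p) ?Pi) {True}"
    by (rule measure_map_pmf[symmetric])
  also have "\<dots> = singlet_prob \<theta> E p"
    using assms by (simp add: Pi_pmf_component finite_imp_finite_nsets measure_pmf_single)
  finally show ?thesis .
qed

lemma routing_rate_bounds:
  assumes "honeycomb_piece V E" "0 < \<theta>" "\<theta> < pi / 4" "0 \<le> a"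
  shows "a * edge_success \<theta> / (real (card V) ^ 2 * real (min_window V E)) \<le> routing_rate a \<theta> V E"
    and "routing_rate a \<theta> V E \<le> a * real (card V) ^ 3 / real (min_window V E)"
proof -
  note piece = honeycomb_pieceD[OF assms(1)]
  let ?p = "pmf_of_set (nsets V 2)" and ?B = "bell_graph_pmf \<theta> V E"
  let ?f = "\<lambda>(p, B). phys_dist a p * real (max_routing B p)"
  have setB: "set_pmf ?B \<subseteq> Pow (nsets V 2)" by (auto simp: bell_graph_pmf_def)
  have set: "x \<in> nsets V 2 \<times> Pow (nsets V 2)" if "x \<in> set_pmf (pair_pmf ?p ?B)" for x
    using that setB piece by auto
  then have "set_pmf (pair_pmf ?p ?B) \<subseteq> nsets V 2 \<times> Pow (nsets V 2)" by blast
  then have fin: "finite (set_pmf (pair_pmf ?p ?B))"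
    using piece(6) finite_subset by blast
  note int = integrable_measure_pmf_finite[OF fin]
  have "?f x \<le> a * real (card V) ^ 3" if x_in: "x \<in> set_pmf (pair_pmf ?p ?B)" for x
  proof -
    obtain p B where x: "x = (p, B)" "p \<in> nsets V 2" "B \<subseteq> nsets V 2" using set[OF x_in] by auto
    have "max_routing B p \<le> card B"
      using x piece(6) by (intro max_routing_bounds) (auto simp: nsets_def intro: finite_subset)
    also have "\<dots> \<le> card (nsets V 2)" using x piece(6) by (intro card_mono)
    also have "\<dots> \<le> (card V)\<^sup>2" by (rule card_nsets_2_le[OF piece(1)])
    finally have "phys_dist a p * real (max_routing B p) \<le> (a * real (card V)) * real ((card V)\<^sup>2)"
      using phys_dist_le[OF assms(1) x(2) assms(4)] assms(4) by (intro mult_mono of_nat_mono) auto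
    then show ?thesis by (simp add: x power2_eq_square power3_eq_cube mult_ac)
  qed
  then have "measure_pmf.expectation (pair_pmf ?p ?B) ?f \<le> a * real (card V) ^ 3"
    by (intro measure_pmf.integral_le_const int) (simp add: AE_measure_pmf_iff)
  then show "routing_rate a \<theta> V E \<le> a * real (card V) ^ 3 / real (min_window V E)"
    by (simp add: routing_rate_def divide_right_mono)
  obtain e where e: "e \<in> E" "e \<in> nsets V 2" using piece by blast
  \<comment> \<open>The event that the session is the edge \<open>e\<close> and its own state was
    converted. On it the payoff is at least \<open>a\<close>, and its probability
    factorizes.\<close>
  define S where "S = {e} \<times> {B. B \<subseteq> nsets V 2 \<and> e \<in> B}"
  have "{B. B \<subseteq> nsets V 2 \<and> e \<in> B} \<subseteq> Pow (nsets V 2)" by blast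
  then have cnt: "countable {B. B \<subseteq> nsets V 2 \<and> e \<in> B}"
    using piece(6) by (meson countable_finite finite_Pow_iff finite_subset)
  have sp: "singlet_prob \<theta> E e = edge_success \<theta>"
    using retained_schmidt_edge[OF assms(2,3) piece(5) e(1)] edge_success_bounds[OF assms(2,3)]
    by (simp add: singlet_prob_def)
  have "measure_pmf.prob ?p {e} = 1 / real (card (nsets V 2))"
    using piece e by (simp add: measure_pmf_single)
  then have prob: "measure_pmf.prob (pair_pmf ?p ?B) S = edge_success \<theta> / real (card (nsets V 2))"
    unfolding S_def measure_pmf_prob_product[OF countable_insert[OF countable_empty] cnt]
    using prob_bell_graph[OF piece(1) e(2), of \<theta> E] sp edge_success_bounds[OF assms(2,3)] by simp
  have "a * indicator S x \<le> ?f x" if x_in: "x \<in> set_pmf (pair_pmf ?p ?B)" for x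
  proof -
    obtain p B where x: "x = (p, B)" "p \<in> nsets V 2" "B \<subseteq> nsets V 2" using set[OF x_in] by auto
    show ?thesis
    proof (cases "x \<in> S")
      case True
      then have "p = e" "e \<in> B" by (auto simp: S_def x)
      moreover have "1 \<le> max_routing B e"
        using x piece(6) e(2) \<open>e \<in> B\<close>
        by (intro max_routing_bounds) (auto simp: nsets_def intro: finite_subset)
      moreover have "phys_dist a e = a" using phys_dist_edge[of E V e a] piece e assms(4) by simp
      ultimately show ?thesis using assms(4) True
        by (simp add: x mult_le_cancel_left1)
    next
      case False
      then show ?thesis using phys_dist_nonneg[OF x(2)] by (simp add: x)
    qed
  qed
  then have "measure_pmf.expectation (pair_pmf ?p ?B) (\<lambda>x. a * indicator S x)
      \<le> measure_pmf.expectation (pair_pmf ?p ?B) ?f"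
    by (intro integral_mono_AE int) (simp add: AE_measure_pmf_iff)
  then have "a * (edge_success \<theta> / real (card (nsets V 2))) \<le> measure_pmf.expectation (pair_pmf ?p ?B) ?f"
    using prob by simp
  moreover have "a * edge_success \<theta> / real ((card V)\<^sup>2) \<le> a * edge_success \<theta> / real (card (nsets V 2))"
    using assms(4) edge_success_bounds[OF assms(2,3)]
    by (intro divide_card_nsets_2_le[OF piece(1,7)]) simp
  ultimately have "a * edge_success \<theta> / real ((card V)\<^sup>2) \<le> measure_pmf.expectation (pair_pmf ?p ?B) ?f"
    by simp
  then have "1 / real (min_window V E) * (a * edge_success \<theta> / real ((card V)\<^sup>2)) \<le> routing_rate a \<theta> V E"
    unfolding routing_rate_def by (intro mult_left_mono) auto
  then show "a * edge_success \<theta> / (real (card V) ^ 2 * real (min_window V E)) \<le> routing_rate a \<theta> V E"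
    by (simp add: mult_ac)
qed


subsection \<open>Asymptotics\<close>

text \<open>With \<open>x = sqrt N\<close> one has \<open>ln N = 2 * ln x\<close>, so the claim
  reduces to \<open>ln x / x\<close> tending to 0.\<close>

lemma ln_card_smallo:
  fixes N :: "nat \<Rightarrow> real"
  assumes "filterlim N at_top sequentially"
  shows "(\<lambda>n. k * ln (N n) + c) \<in> o(\<lambda>n. sqrt (N n))"
proof -
  have "((\<lambda>x. 2 * k * (ln x / x) + c * inverse x) \<longlongrightarrow> 2 * k * 0 + c * 0) at_top"
    by (intro tendsto_intros ln_x_over_x_tendsto_0 tendsto_inverse_0_at_top filterlim_ident)
  then have lim: "((\<lambda>x. (2 * k * ln x + c) / x) \<longlongrightarrow> 0) at_top"
    by (simp add: divide_inverse distrib_right mult.assoc)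
  have "(\<lambda>x. 2 * k * ln x + c) \<in> o[at_top](\<lambda>x. x)"
    using lim by (intro smalloI_tendsto) (auto intro: eventually_gt_at_top[THEN eventually_mono, of 0])
  moreover have s: "filterlim (\<lambda>n. sqrt (N n)) at_top sequentially"
    using assms sqrt_at_top filterlim_compose by blast
  ultimately have "(\<lambda>n. 2 * k * ln (sqrt (N n)) + c) \<in> o(\<lambda>n. sqrt (N n))"
    by (rule landau_o.small.compose)
  moreover have "\<forall>\<^sub>F n in sequentially. 2 * k * ln (sqrt (N n)) + c = k * ln (N n) + c"
    using filterlim_at_top_dense[THEN iffD1, OF assms, rule_format, of 0]
    by eventually_elim (simp add: ln_sqrt)
  ultimately show ?thesis
    by (simp cong: landau_o.small.in_cong)
qed

text \<open>The exponent \<open>- ln r\<close> differs from \<open>ln W\<close> by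
  \<open>O(ln N)\<close>, which is negligible against \<open>sqrt N\<close>, so it inherits the
  order of \<open>ln W\<close>.\<close>

lemma stretched_exponential_decay:
  fixes N W r :: "nat \<Rightarrow> real"
  assumes N: "filterlim N at_top sequentially"
    and W: "(\<lambda>n. ln (W n)) \<in> \<Theta>(\<lambda>n. sqrt (N n))" "\<forall>\<^sub>F n in sequentially. 1 \<le> W n"
    and "0 < c" "0 < C"
    and r: "\<forall>\<^sub>F n in sequentially. c / (N n ^ 2 * W n) \<le> r n \<and> r n \<le> C * N n ^ 3 / W n"
  shows "\<exists>h \<in> \<Theta>(\<lambda>n. sqrt (N n)). \<forall>\<^sub>F n in sequentially. 0 \<le> h n \<and> r n = exp (- h n)"
proof -
  define h where "h n = - ln (r n)" for n
  define k where "k = \<bar>ln c\<bar> + \<bar>ln C\<bar>"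
  have N1: "\<forall>\<^sub>F n in sequentially. 1 < N n"
    using N by (simp add: filterlim_at_top_dense)
  \<comment> \<open>The factor 3 is the larger of the exponents of \<open>N\<close> in the two
    bounds, and \<open>k\<close> absorbs both constants.\<close>
  have err: "\<forall>\<^sub>F n in sequentially. 0 < r n \<and> \<bar>h n - ln (W n)\<bar> \<le> 3 * ln (N n) + k"
    using N1 W(2) r
  proof eventually_elim
    case (elim n)
    have pos: "0 < c / (N n ^ 2 * W n)" using elim assms(4) by simp
    then have r_pos: "0 < r n" using elim by linarith
    have "ln (c / (N n ^ 2 * W n)) \<le> ln (r n)" using elim pos r_pos by (intro ln_mono) auto
    moreover have "ln (c / (N n ^ 2 * W n)) = ln c - (2 * ln (N n) + ln (W n))"
      using elim assms(4) by (simp add: ln_div ln_mult ln_realpow)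
    moreover have "ln (r n) \<le> ln (C * N n ^ 3 / W n)" using elim r_pos by (intro ln_mono) auto
    moreover have "ln (C * N n ^ 3 / W n) = ln C + 3 * ln (N n) - ln (W n)"
      using elim assms(5) by (simp add: ln_div ln_mult ln_realpow)
    moreover have "0 \<le> ln (N n)" using elim by simp
    ultimately show ?case using r_pos unfolding h_def k_def by linarith
  qed
  then have "(\<lambda>n. h n - ln (W n)) \<in> O(\<lambda>n. 3 * ln (N n) + k)"
    by (intro bigoI[of _ 1]) (auto elim!: eventually_mono)
  also have "(\<lambda>n. 3 * ln (N n) + k) \<in> o(\<lambda>n. sqrt (N n))"
    by (rule ln_card_smallo[OF N])
  finally have small: "(\<lambda>n. h n - ln (W n)) \<in> o(\<lambda>n. sqrt (N n))" .
  also have "(\<lambda>n. sqrt (N n)) \<in> O(\<lambda>n. ln (W n))"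
    using W(1) by (simp add: bigtheta_def bigomega_iff_bigo)
  finally have small': "(\<lambda>n. h n - ln (W n)) \<in> o(\<lambda>n. ln (W n))" .
  have "\<Theta>(\<lambda>n. ln (W n) + (h n - ln (W n))) = \<Theta>(\<lambda>n. ln (W n))"
    by (rule landau_theta.plus_absorb2[OF small'])
  then have "\<Theta>(h) = \<Theta>(\<lambda>n. ln (W n))"
    by simp
  moreover have "h \<in> \<Theta>(h)"
    by simp
  ultimately have "h \<in> \<Theta>(\<lambda>n. ln (W n))"
    by (simp only:)
  then have "h \<in> \<Theta>(\<lambda>n. sqrt (N n))"
    using W(1) landau_theta.trans by blast
  \<comment> \<open>The constant 1 suffices: an error of at most \<open>ln (W n)\<close> leaves
    \<open>h n\<close> nonnegative.\<close>
  moreover have "\<forall>\<^sub>F n in sequentially. norm (h n - ln (W n)) \<le> 1 * norm (ln (W n))"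
    using landau_o.smallD[OF small', of 1] by simp
  then have "\<forall>\<^sub>F n in sequentially. 0 \<le> h n \<and> r n = exp (- h n)"
    using err W(2)
  proof eventually_elim
    case (elim n)
    then have "0 \<le> ln (W n)" by simp
    then have "0 \<le> h n" using elim by auto
    then show ?case using elim by (simp add: h_def)
  qed
  ultimately show ?thesis by blast
qed

text \<open>The cube counts at most \<open>N ^ 2\<close> pairs and \<open>N\<close> starting points
  of walks.\<close>

lemma min_window_le:
  assumes "honeycomb_piece V E" "\<forall>v\<in>V. card {e \<in> E. v \<in> e} \<le> 3"
  shows "min_window V E \<le> card V ^ 3 * 3 ^ Max (hop_dist E ` nsets V 2)"
proof -
  note piece = honeycomb_pieceD[OF assms(1)]
  let ?h = "Max (hop_dist E ` nsets V 2)"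
  have "link_load V E e \<le> card (nsets V 2) * (card V * 3 ^ ?h)" for e
    using piece assms(2) by (intro link_load_le) auto
  then have "min_window V E \<le> card (nsets V 2) * (card V * 3 ^ ?h)"
    using piece by (simp add: min_window_eq_Max)
  also have "\<dots> \<le> (card V)\<^sup>2 * (card V * 3 ^ ?h)"
    using card_nsets_2_le[OF piece(1)] by (intro mult_right_mono) auto
  finally show ?thesis by (simp add: power2_eq_square power3_eq_cube mult_ac)
qed

lemma min_window_ge:
  assumes "honeycomb_piece V E" "coord_block i j m \<subseteq> V"
    and "honeycomb_edges \<inter> nsets (coord_block i j m) 2 \<subseteq> E"
  shows "2 ^ m \<le> min_window V E"
proof -
  note piece = honeycomb_pieceD[OF assms(1)]
  obtain e where e: "e \<in> E" "2 ^ m \<le> link_load V E e"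
    using exponential_link_load[OF piece(1) _ assms(2,3)] piece(4,5) by blast
  then show ?thesis
    unfolding min_window_eq_Max[OF piece(1-3)] using piece(2) by (meson Max_ge finite_imageI imageI order_trans)
qed

text \<open>With \<open>m\<close> the side of the block and \<open>H\<close> the hop diameter,
  \<open>ln W\<close> lies between \<open>m * ln 2\<close> and \<open>3 * ln N + H * ln 3\<close>;
  the family conditions make both ends of order \<open>sqrt N\<close> in the required
  direction.\<close>

lemma ln_min_window_bigtheta:
  assumes "honeycomb_family V E"
  shows "(\<lambda>n. ln (real (min_window (V n) (E n)))) \<in> \<Theta>(\<lambda>n. sqrt (real (card (V n))))"
    and "1 \<le> min_window (V n) (E n)"
proof -
  let ?N = "\<lambda>n. real (card (V n))" and ?W = "\<lambda>n. real (min_window (V n) (E n))"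
  let ?H = "\<lambda>n. Max (hop_dist (E n) ` nsets (V n) 2)"
  have piece: "honeycomb_piece (V n) (E n)" and deg: "\<forall>v \<in> V n. card {e \<in> E n. v \<in> e} \<le> 3" for n
    using assms unfolding honeycomb_family_def by blast+
  have lim: "filterlim (\<lambda>n. card (V n)) at_top sequentially"
    and hop: "(\<lambda>n. real (?H n)) \<in> O(\<lambda>n. sqrt (?N n))"
    using assms unfolding honeycomb_family_def by blast+
  obtain m i j where m: "(\<lambda>n. real (m n)) \<in> \<Theta>(\<lambda>n. sqrt (?N n))"
    and block: "coord_block (i n) (j n) (m n) \<subseteq> V n"
      "honeycomb_edges \<inter> nsets (coord_block (i n) (j n) (m n)) 2 \<subseteq> E n" for n
    using assms unfolding honeycomb_family_def by blast
  have N: "filterlim ?N at_top sequentially"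
    using lim filterlim_compose filterlim_real_sequentially by blast
  have W_ge: "2 ^ m n \<le> min_window (V n) (E n)" for n
    by (rule min_window_ge[OF piece block])
  then show W1: "1 \<le> min_window (V n) (E n)" for n
    using one_le_power[of "2 :: nat" "m n"] order_trans by (metis one_le_numeral)
  have lower: "real (m n) * ln 2 \<le> ln (?W n)" for n
  proof -
    have "ln (2 ^ m n) \<le> ln (?W n)"
      using of_nat_mono[OF W_ge[of n], where 'a = real] by (intro ln_mono) simp_all
    then show ?thesis by (simp add: ln_realpow)
  qed
  have upper: "ln (?W n) \<le> 3 * ln (?N n) + real (?H n) * ln 3" for n
  proof -
    have "0 < ?N n" using piece[of n] by (simp add: honeycomb_piece_def)
    moreover have "?W n \<le> ?N n ^ 3 * 3 ^ ?H n"
      using of_nat_mono[OF min_window_le[OF piece deg, of n], where 'a = real] by simp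
    then have "ln (?W n) \<le> ln (?N n ^ 3 * 3 ^ ?H n)"
      using W1[of n] by (intro ln_mono) auto
    ultimately show ?thesis by (simp add: ln_mult ln_realpow)
  qed
  have "(\<lambda>n. ln (?W n)) \<in> O(\<lambda>n. 3 * ln (?N n) + real (?H n) * ln 3)"
    using upper W1 by (intro bigoI[of _ 1] always_eventually) (auto intro: order_trans[OF _ abs_ge_self])
  also have "(\<lambda>n. 3 * ln (?N n) + real (?H n) * ln 3) \<in> O(\<lambda>n. sqrt (?N n))"
    using ln_card_smallo[OF N, of 3 0] hop
    by (intro sum_in_bigo) (auto dest: landau_o.small_imp_big)
  finally have up: "(\<lambda>n. ln (?W n)) \<in> O(\<lambda>n. sqrt (?N n))" .
  have "(\<lambda>n. sqrt (?N n)) \<in> O(\<lambda>n. real (m n))"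
    using m by (simp add: bigtheta_def bigomega_iff_bigo)
  also have "(\<lambda>n. real (m n)) \<in> O(\<lambda>n. ln (?W n))"
  proof (intro bigoI[of _ "1 / ln 2"] always_eventually allI)
    fix n show "norm (real (m n)) \<le> 1 / ln 2 * norm (ln (?W n))"
      using lower[of n] W1[of n] by (simp add: field_simps)
  qed
  finally show "(\<lambda>n. ln (?W n)) \<in> \<Theta>(\<lambda>n. sqrt (?N n))"
    using up by (simp add: bigtheta_def bigomega_iff_bigo)
qed

theorem proposition5:
  fixes V :: "nat \<Rightarrow> vertex set" and E :: "nat \<Rightarrow> vertex set set" and a \<theta> :: real
  assumes "honeycomb_family V E"
    and "0 < a"
    and "0 < \<theta>" and "\<theta> < pi / 4"
  shows "(\<forall>n. min_window (V n) (E n) = Max (link_load (V n) (E n) ` E n))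
    \<and> (\<exists>h \<in> \<Theta>(\<lambda>n. sqrt (real (card (V n)))). \<forall>\<^sub>F n in sequentially.
          0 \<le> h n \<and> real (min_window (V n) (E n)) = exp (h n))
    \<and> (\<exists>h \<in> \<Theta>(\<lambda>n. sqrt (real (card (V n)))). \<forall>\<^sub>F n in sequentially.
          0 \<le> h n \<and> optimal_locc_rate a \<theta> (V n) (E n) = ereal (exp (- h n)))
    \<and> (\<exists>h \<in> \<Theta>(\<lambda>n. sqrt (real (card (V n)))). \<forall>\<^sub>F n in sequentially.
          0 \<le> h n \<and> routing_rate a \<theta> (V n) (E n) = exp (- h n))"
proof (intro conjI)
  let ?N = "\<lambda>n. real (card (V n))" and ?W = "\<lambda>n. real (min_window (V n) (E n))"
  have piece: "honeycomb_piece (V n) (E n)" for n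
    using assms(1) unfolding honeycomb_family_def by blast
  have lim: "filterlim (\<lambda>n. card (V n)) at_top sequentially"
    using assms(1) unfolding honeycomb_family_def by blast
  have N: "filterlim ?N at_top sequentially"
    using lim filterlim_compose filterlim_real_sequentially by blast
  have W: "(\<lambda>n. ln (?W n)) \<in> \<Theta>(\<lambda>n. sqrt (?N n))"
    by (rule ln_min_window_bigtheta[OF assms(1)])
  have W1: "1 \<le> ?W n" for n
    using ln_min_window_bigtheta(2)[OF assms(1), of n] by simp
  have pos: "0 < a * edge_success \<theta>" "0 \<le> a"
    using assms(2) edge_success_bounds[OF assms(3,4)] by auto
  note decay = stretched_exponential_decay[OF N W always_eventually[OF allI[OF W1]] pos(1) assms(2)]
  show "\<forall>n. min_window (V n) (E n) = Max (link_load (V n) (E n) ` E n)"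
    by (intro allI min_window_eq_Max honeycomb_pieceD(1-3)[OF piece])
  show "\<exists>h \<in> \<Theta>(\<lambda>n. sqrt (?N n)). \<forall>\<^sub>F n in sequentially. 0 \<le> h n \<and> ?W n = exp (h n)"
  proof (rule bexI[OF _ W], rule always_eventually, rule allI)
    fix n show "0 \<le> ln (?W n) \<and> ?W n = exp (ln (?W n))"
      using W1[of n] by simp
  qed
  \<comment> \<open>The decay lemma speaks of real sequences; the supremum is squeezed between real
    numbers, so its real value loses nothing.\<close>
  define r where "r n = real_of_ereal (optimal_locc_rate a \<theta> (V n) (E n))" for n
  have r: "optimal_locc_rate a \<theta> (V n) (E n) = ereal (r n)
    \<and> a * edge_success \<theta> / (?N n ^ 2 * ?W n) \<le> r n \<and> r n \<le> a * ?N n ^ 3 / ?W n" for n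
    by (rule optimal_locc_rate_bounds[OF piece[of n] assms(3,4) pos(2)]) (simp add: r_def)
  then have "\<exists>h \<in> \<Theta>(\<lambda>n. sqrt (?N n)). \<forall>\<^sub>F n in sequentially. 0 \<le> h n \<and> r n = exp (- h n)"
    by (intro decay always_eventually allI) simp
  then show "\<exists>h \<in> \<Theta>(\<lambda>n. sqrt (?N n)). \<forall>\<^sub>F n in sequentially.
      0 \<le> h n \<and> optimal_locc_rate a \<theta> (V n) (E n) = ereal (exp (- h n))"
    using r by simp
  show "\<exists>h \<in> \<Theta>(\<lambda>n. sqrt (?N n)). \<forall>\<^sub>F n in sequentially.
      0 \<le> h n \<and> routing_rate a \<theta> (V n) (E n) = exp (- h n)"
    by (intro decay always_eventually allI conjI routing_rate_bounds[OF piece assms(3,4) pos(2)])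
qed

end
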